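(* Let $\mathcal{A}\subset\mathbb{R}^d$ be a finite set whose convex hull $\Delta$ has dimension $d$. A (rational) patch $\beta=\{\beta_{\mathbf a}\mid\mathbf a\in\mathcal{A}\}$ on $\Delta$ has rational linear precision if and only if the complexified tautological projection $$\pi_{\mathcal{A}}\colon Y_\beta \dashrightarrow \mathbb{C}\mathbb{P}^d$$ is a birational isomorphism.
   Context: A (parametric) patch indexed by a finite set $\mathcal{A}\subset\mathbb{R}^d$ with full-dimensional convex hull $\Delta$ is a collection $\{\beta_{\mathbf a}\mid\mathbf a\in\mathcal{A}\}$ of non-negative real-valued functions (blending functions), smooth where defined, with common domain $\Delta$, that do not vanish simultaneously at any point of $\Delta$. They may be normalized by dividing by $\sum_{\mathbf b}\beta_{\mathbf b}$, so that they sum to $1$. The (normalized) patch has linear precision if for every affine function $\Lambda$ on $\mathbb{R}^d$, $\Lambda(x)=\sum_{\mathbf a}\beta_{\mathbf a}(x)\Lambda(\mathbf a)$ for all $x\in\Delta$. Its tautological map is $\tau\colon\Delta\to\Delta$, $\tau(x)=\sum_{\mathbf a}\beta_{\mathbf a}(x)\mathbf a$ (normalized $\beta_{\mathbf a}$); the patch is proper if $\tau$ is a homeomorphism. The reparametrization by a homeomorphism $\psi\colon\Delta\to\Delta$ is the patch $\{\beta_{\mathbf a}\circ\psi\}$. A proper patch has a unique reparametrization with linear precision (namely by $\psi=\tau^{-1}$). A patch is rational if it has a reparametrization whose normalized blending functions are rational functions (quotients of polynomials). A patch has rational linear precision if it is proper and its reparametrization having linear precision has blending functions that are rational functions. Let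 $\mathbb{C}\mathbb{P}^{\mathcal{A}}$ be the complex projective space with homogeneous coordinates indexed by $\mathcal{A}$. For a rational patch, reparametrize so that the blending functions are rational and clear denominators so that they are polynomials $\beta_{\mathbf a}$; let $B\subset\mathbb{C}^d$ be their common zero set. Then $Y_\beta\subset\mathbb{C}\mathbb{P}^{\mathcal{A}}$ is the Zariski closure of the image of $\mathbb{C}^d\setminus B\to\mathbb{C}\mathbb{P}^{\mathcal{A}}$, $x\mapsto[\beta_{\mathbf a}(x)\mid\mathbf a\in\mathcal{A}]$. The tautological projection is the linear projection $\pi_{\mathcal{A}}\colon\mathbb{C}\mathbb{P}^{\mathcal{A}}\dashrightarrow\mathbb{C}\mathbb{P}^d$, $[y_{\mathbf a}\mid\mathbf a\in\mathcal{A}]\mapsto\sum_{\mathbf a\in\mathcal{A}}y_{\mathbf a}\cdot(1,\mathbf a)\in\mathbb{C}^{d+1}$ (viewed in $\mathbb{C}\mathbb{P}^d$), defined where the sum is non-zero; above it is restricted to $Y_\beta$. A rational map is a birational isomorphism if it has an inverse rational map, the two composites being the identity where they are defined.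
   Formalization: The patch is additionally assumed proper (its tautological map is a homeomorphism); otherwise the converse fails, e.g. A={0,1}, β_0=(x-1/2)^2, β_1=1-(x-1/2)^2: the projection is an isomorphism of CP^1 but the patch is not proper. *)

theory Defs
  imports "HOL-Analysis.Analysis" "HOL-Library.Poly_Mapping"
begin

section \<open>Multivariate polynomials\<close>

text \<open>
  A monomial is a finitely supported exponent map and a polynomial is a finitely supported
  coefficient map; \<open>Poly_Mapping\<close> supplies the ring structure.
\<close>

type_synonym ('v, 'a) mpoly = "('v \<Rightarrow>\<^sub>0 nat) \<Rightarrow>\<^sub>0 'a"

definition mpoly_eval :: "('v, 'a::comm_semiring_1) mpoly \<Rightarrow> ('v \<Rightarrow> 'a) \<Rightarrow> 'a" where
  "mpoly_eval p x =
     (\<Sum>m\<in>Poly_Mapping.keys p.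
        Poly_Mapping.lookup p m * (\<Prod>v\<in>Poly_Mapping.keys m. x v ^ Poly_Mapping.lookup m v))"

abbreviation complexify :: "('v, real) mpoly \<Rightarrow> ('v, complex) mpoly" where
  "complexify \<equiv> Poly_Mapping.map complex_of_real"

text \<open>Homogeneous polynomials of degree \<open>k\<close> (including 0) in the variables indexed by \<open>I\<close>.\<close>

definition forms :: "'v set \<Rightarrow> nat \<Rightarrow> ('v, 'a::comm_semiring_1) mpoly set" where
  "forms I k = {p. \<forall>m\<in>Poly_Mapping.keys p.
     Poly_Mapping.keys m \<subseteq> I \<and> (\<Sum>v\<in>Poly_Mapping.keys m. Poly_Mapping.lookup m v) = k}"

text \<open>
  A function on \<open>S\<close> is rational if it agrees with a quotient of polynomials wherever the (nonzero)
  denominator does not vanish.  The denominator may have zeros in \<open>S\<close>.  This is meant for continuous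
  functions on a set \<open>S\<close> with dense interior, for which the values at such zeros
  are determined by continuity.
\<close>

definition rational_on :: "(real ^ 'n) set \<Rightarrow> (real ^ 'n \<Rightarrow> real) \<Rightarrow> bool" where
  "rational_on S f \<longleftrightarrow>
     (\<exists>p q :: ('n, real) mpoly. q \<noteq> 0 \<and>
        (\<forall>x\<in>S. mpoly_eval q (($) x) \<noteq> 0 \<longrightarrow>
           f x = mpoly_eval p (($) x) / mpoly_eval q (($) x)))"


section \<open>Parametric patches\<close>

text \<open>Functions with continuous partial derivatives of all orders up to \<open>k\<close> on an open set \<open>U\<close>.\<close>

fun Ck_on :: "nat \<Rightarrow> (real ^ 'n) set \<Rightarrow> (real ^ 'n \<Rightarrow> real) \<Rightarrow> bool" where
  "Ck_on 0 U f \<longleftrightarrow> continuous_on U f"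
| "Ck_on (Suc k) U f \<longleftrightarrow>
     (\<exists>g :: 'n \<Rightarrow> real ^ 'n \<Rightarrow> real.
        (\<forall>x\<in>U. (f has_derivative (\<lambda>h. \<Sum>i\<in>UNIV. g i x * h $ i)) (at x)) \<and>
        (\<forall>i. Ck_on k U (g i)))"

definition smooth_on :: "(real ^ 'n) set \<Rightarrow> (real ^ 'n \<Rightarrow> real) \<Rightarrow> bool" where
  "smooth_on U f \<longleftrightarrow> (\<forall>k. Ck_on k U f)"

text \<open>
  Blending functions are total functions in Isabelle, but only their values on the convex hull of
  \<open>A\<close> matter.  Smoothness is required in the interior and continuity up to the boundary, so that
  functions such as monomials with real exponents in the facet equations are admitted.
\<close>

definition patch :: "(real ^ 'n) set \<Rightarrow> (real ^ 'n \<Rightarrow> real ^ 'n \<Rightarrow> real) \<Rightarrow> bool" where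
  "patch A \<beta> \<longleftrightarrow>
     (\<forall>a\<in>A. continuous_on (convex hull A) (\<beta> a) \<and> smooth_on (interior (convex hull A)) (\<beta> a)) \<and>
     (\<forall>a\<in>A. \<forall>x\<in>convex hull A. 0 \<le> \<beta> a x) \<and>
     (\<forall>x\<in>convex hull A. \<exists>a\<in>A. \<beta> a x \<noteq> 0)"

definition normalized ::
    "(real ^ 'n) set \<Rightarrow> (real ^ 'n \<Rightarrow> real ^ 'n \<Rightarrow> real) \<Rightarrow> real ^ 'n \<Rightarrow> real ^ 'n \<Rightarrow> real" where
  "normalized A \<beta> a x = \<beta> a x / (\<Sum>b\<in>A. \<beta> b x)"

definition reparam ::
    "(real ^ 'n \<Rightarrow> real ^ 'n \<Rightarrow> real) \<Rightarrow> (real ^ 'n \<Rightarrow> real ^ 'n) \<Rightarrow> real ^ 'n \<Rightarrow> real ^ 'n \<Rightarrow> real" where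
  "reparam \<beta> \<psi> a = \<beta> a \<circ> \<psi>"

definition linear_precision ::
    "(real ^ 'n) set \<Rightarrow> (real ^ 'n \<Rightarrow> real ^ 'n \<Rightarrow> real) \<Rightarrow> bool" where
  "linear_precision A \<beta> \<longleftrightarrow>
     (\<forall>(l :: real ^ 'n \<Rightarrow> real) c. linear l \<longrightarrow>
        (\<forall>x\<in>convex hull A. l x + c = (\<Sum>a\<in>A. normalized A \<beta> a x * (l a + c))))"

definition tautological_map ::
    "(real ^ 'n) set \<Rightarrow> (real ^ 'n \<Rightarrow> real ^ 'n \<Rightarrow> real) \<Rightarrow> real ^ 'n \<Rightarrow> real ^ 'n" where
  "tautological_map A \<beta> x = (\<Sum>a\<in>A. normalized A \<beta> a x *\<^sub>R a)"

definition proper_patch :: "(real ^ 'n) set \<Rightarrow> (real ^ 'n \<Rightarrow> real ^ 'n \<Rightarrow> real) \<Rightarrow> bool" where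
  "proper_patch A \<beta> \<longleftrightarrow>
     (\<exists>\<phi>. homeomorphism (convex hull A) (convex hull A) (tautological_map A \<beta>) \<phi>)"

definition rational_patch :: "(real ^ 'n) set \<Rightarrow> (real ^ 'n \<Rightarrow> real ^ 'n \<Rightarrow> real) \<Rightarrow> bool" where
  "rational_patch A \<beta> \<longleftrightarrow>
     (\<exists>\<psi> \<phi>. homeomorphism (convex hull A) (convex hull A) \<psi> \<phi> \<and>
        (\<forall>a\<in>A. rational_on (convex hull A) (normalized A (reparam \<beta> \<psi>) a)))"

definition rational_linear_precision ::
    "(real ^ 'n) set \<Rightarrow> (real ^ 'n \<Rightarrow> real ^ 'n \<Rightarrow> real) \<Rightarrow> bool" where
  "rational_linear_precision A \<beta> \<longleftrightarrow>
     proper_patch A \<beta> \<and>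
     (\<exists>\<psi> \<phi>. homeomorphism (convex hull A) (convex hull A) \<psi> \<phi> \<and>
        linear_precision A (reparam \<beta> \<psi>) \<and>
        (\<forall>a\<in>A. rational_on (convex hull A) (normalized A (reparam \<beta> \<psi>) a)))"

text \<open>
  The polynomials \<open>b a\<close> arise from some reparametrization with rational normalized blending
  functions by multiplying with a common denominator \<open>h\<close>.
\<close>

definition cleared_patch ::
    "(real ^ 'n) set \<Rightarrow> (real ^ 'n \<Rightarrow> real ^ 'n \<Rightarrow> real) \<Rightarrow> (real ^ 'n \<Rightarrow> ('n, real) mpoly) \<Rightarrow> bool" where
  "cleared_patch A \<beta> b \<longleftrightarrow>
     (\<exists>\<psi> \<phi> h. homeomorphism (convex hull A) (convex hull A) \<psi> \<phi> \<and> h \<noteq> 0 \<and>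
        (\<forall>a\<in>A. \<forall>x\<in>convex hull A.
           mpoly_eval (b a) (($) x) = mpoly_eval h (($) x) * normalized A (reparam \<beta> \<psi>) a x))"


section \<open>Complex projective space and rational maps\<close>

text \<open>
  Homogeneous coordinates indexed by \<open>I\<close> are functions vanishing off \<open>I\<close>; a point of projective
  space is the class of a nonzero coordinate vector up to nonzero complex scalars.
\<close>

definition proj_point :: "('i \<Rightarrow> complex) \<Rightarrow> ('i \<Rightarrow> complex) set" where
  "proj_point y = {(\<lambda>i. c * y i) |c. c \<noteq> 0}"

definition proj_space :: "'i set \<Rightarrow> ('i \<Rightarrow> complex) set set" where
  "proj_space I = proj_point ` {y. (\<forall>i. i \<notin> I \<longrightarrow> y i = 0) \<and> (\<exists>i\<in>I. y i \<noteq> 0)}"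

definition zariski_closed :: "'i set \<Rightarrow> ('i \<Rightarrow> complex) set set \<Rightarrow> bool" where
  "zariski_closed I Z \<longleftrightarrow>
     (\<exists>T \<subseteq> (\<Union>k. forms I k). Z = {P \<in> proj_space I. \<forall>F\<in>T. \<forall>y\<in>P. mpoly_eval F y = 0})"

definition zariski_closure :: "'i set \<Rightarrow> ('i \<Rightarrow> complex) set set \<Rightarrow> ('i \<Rightarrow> complex) set set" where
  "zariski_closure I S = zariski_closed I hull S"

text \<open>
  A rational map from \<open>X\<close> (with coordinates indexed by \<open>I\<close>) to \<open>Z\<close> (with coordinates indexed by
  \<open>J\<close>) is given by a family \<open>F\<close> of forms of equal degree; it is defined where not all of
  them vanish, which has to be Zariski dense in \<open>X\<close>.
\<close>

definition rat_dom ::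
    "('i \<Rightarrow> complex) set set \<Rightarrow> 'j set \<Rightarrow> ('j \<Rightarrow> ('i, complex) mpoly) \<Rightarrow> ('i \<Rightarrow> complex) set set" where
  "rat_dom X J F = {P \<in> X. \<exists>y\<in>P. \<exists>j\<in>J. mpoly_eval (F j) y \<noteq> 0}"

definition rat_apply ::
    "'j set \<Rightarrow> ('j \<Rightarrow> ('i, complex) mpoly) \<Rightarrow> ('i \<Rightarrow> complex) set \<Rightarrow> ('j \<Rightarrow> complex) set" where
  "rat_apply J F P = (\<Union>y\<in>P. proj_point (\<lambda>j. if j \<in> J then mpoly_eval (F j) y else 0))"

definition rational_map ::
    "'i set \<Rightarrow> ('i \<Rightarrow> complex) set set \<Rightarrow> 'j set \<Rightarrow> ('j \<Rightarrow> complex) set set \<Rightarrow>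
     ('j \<Rightarrow> ('i, complex) mpoly) \<Rightarrow> bool" where
  "rational_map I X J Z F \<longleftrightarrow>
     (\<exists>k. \<forall>j\<in>J. F j \<in> forms I k) \<and>
     X \<subseteq> zariski_closure I (rat_dom X J F) \<and>
     rat_apply J F ` rat_dom X J F \<subseteq> Z"

text \<open>
  \<open>G\<close> after \<open>F\<close> is the identity of \<open>X\<close> as a rational map.  The density condition says that the
  composite exists as a rational map; without it the identity could hold vacuously.
\<close>

definition rat_left_inverse ::
    "'i set \<Rightarrow> ('i \<Rightarrow> complex) set set \<Rightarrow> 'j set \<Rightarrow> ('j \<Rightarrow> complex) set set \<Rightarrow>
     ('j \<Rightarrow> ('i, complex) mpoly) \<Rightarrow> ('i \<Rightarrow> ('j, complex) mpoly) \<Rightarrow> bool" where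
  "rat_left_inverse I X J Z F G \<longleftrightarrow>
     (let D = {P \<in> rat_dom X J F. rat_apply J F P \<in> rat_dom Z I G} in
        X \<subseteq> zariski_closure I D \<and> (\<forall>P\<in>D. rat_apply I G (rat_apply J F P) = P))"

definition birational_isomorphism ::
    "'i set \<Rightarrow> ('i \<Rightarrow> complex) set set \<Rightarrow> 'j set \<Rightarrow> ('j \<Rightarrow> complex) set set \<Rightarrow>
     ('j \<Rightarrow> ('i, complex) mpoly) \<Rightarrow> bool" where
  "birational_isomorphism I X J Z F \<longleftrightarrow>
     rational_map I X J Z F \<and>
     (\<exists>G. rational_map J Z I X G \<and>
          rat_left_inverse I X J Z F G \<and> rat_left_inverse J Z I X G F)"


section \<open>The variety of a rational patch and the tautological projection\<close>

definition patch_variety ::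
    "(real ^ 'n) set \<Rightarrow> (real ^ 'n \<Rightarrow> ('n, real) mpoly) \<Rightarrow> (real ^ 'n \<Rightarrow> complex) set set" where
  "patch_variety A b =
     zariski_closure A
       {proj_point (\<lambda>a. if a \<in> A then mpoly_eval (complexify (b a)) (($) z) else 0) |z :: complex ^ 'n.
          \<exists>a\<in>A. mpoly_eval (complexify (b a)) (($) z) \<noteq> 0}"

text \<open>
  The coordinates of \<open>d\<close>-dimensional projective space are indexed by \<open>'n option\<close>, where
  \<open>None\<close> is the homogenizing coordinate, so that \<open>lift_coord a\<close> is the vector \<open>(1, a)\<close>.
\<close>

definition lift_coord :: "real ^ 'n \<Rightarrow> 'n option \<Rightarrow> real" where
  "lift_coord a j = (case j of None \<Rightarrow> 1 | Some i \<Rightarrow> a $ i)"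

definition tautological_projection ::
    "(real ^ 'n) set \<Rightarrow> 'n option \<Rightarrow> (real ^ 'n, complex) mpoly" where
  "tautological_projection A j =
     (\<Sum>a\<in>A. Poly_Mapping.single (Poly_Mapping.single a 1) (complex_of_real (lift_coord a j)))"

lemma mpoly_eval_tautological_projection:
  fixes A :: "(real ^ 'n) set"
  assumes "finite A"
  shows "mpoly_eval (tautological_projection A j) y = (\<Sum>a\<in>A. y a * complex_of_real (lift_coord a j))"
proof -
  let ?e = "\<lambda>a :: real ^ 'n. Poly_Mapping.single a (Suc 0)"
  let ?c = "\<lambda>a. complex_of_real (lift_coord a j)"
  let ?p = "tautological_projection A j"
  have inj: "?e a = ?e b \<longleftrightarrow> a = b" for a b
    by (metis lookup_single_eq lookup_single_not_eq nat.distinct(1))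
  have lk: "Poly_Mapping.lookup ?p m = (\<Sum>a\<in>A. if ?e a = m then ?c a else 0)" for m
    by (simp add: tautological_projection_def lookup_sum lookup_single when_def)
  have lke: "Poly_Mapping.lookup ?p (?e b) = ?c b" if "b \<in> A" for b
    using that assms by (simp add: lk inj)
  have sub: "Poly_Mapping.keys ?p \<subseteq> ?e ` A"
  proof
    fix m assume "m \<in> Poly_Mapping.keys ?p"
    then have "(\<Sum>a\<in>A. if ?e a = m then ?c a else 0) \<noteq> 0"
      by (simp add: in_keys_iff lk)
    then show "m \<in> ?e ` A"
      by (auto elim!: sum.not_neutral_contains_not_neutral split: if_splits)
  qed
  have "mpoly_eval ?p y =
      (\<Sum>m\<in>?e ` A. Poly_Mapping.lookup ?p m * (\<Prod>v\<in>Poly_Mapping.keys m. y v ^ Poly_Mapping.lookup m v))"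
    unfolding mpoly_eval_def
    by (rule sum.mono_neutral_left) (use assms sub in \<open>auto simp: in_keys_iff\<close>)
  also have "\<dots> = (\<Sum>a\<in>A. Poly_Mapping.lookup ?p (?e a) * y a)"
    by (subst sum.reindex) (auto simp: inj_on_def inj)
  also have "\<dots> = (\<Sum>a\<in>A. y a * ?c a)"
    by (rule sum.cong) (auto simp: lke)
  finally show ?thesis .
qed

end

theory Submission
  imports Defs "HOL-Computational_Algebra.Polynomial"
begin

text \<open>
  Let \<open>C a = normalized A \<beta> a \<circ> \<tau>\<^sup>-\<^sup>1\<close>, the blending functions of the reparametrization with
  linear precision.  The variety of the patch is the Zariski closure of the points \<open>[C x]\<close> with
  \<open>x\<close> in the convex hull \<open>\<Delta>\<close> of \<open>A\<close>, and linear precision says that the tautological projection maps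
  \<open>[C x]\<close> to \<open>[1, x]\<close>.  If \<open>C a = g a / q\<close> with polynomials, then the homogenizations of the
  \<open>g a\<close> give an inverse rational map.  Conversely, an inverse \<open>G\<close> satisfies
  \<open>[G (1, x)] = [C x]\<close>, and since the \<open>C a\<close> sum to 1 they are the quotients
  \<open>G a (1, x) / (\<Sum>c\<in>A. G c (1, x))\<close>, whose real parts can be taken.
  Every density argument reduces to the fact that a nonzero polynomial does not vanish identically
  on a set with nonempty interior.
\<close>

section \<open>Evaluation of multivariate polynomials\<close>

definition monom_eval :: "('v \<Rightarrow>\<^sub>0 nat) \<Rightarrow> ('v \<Rightarrow> 'a::comm_semiring_1) \<Rightarrow> 'a" where
  "monom_eval m x = (\<Prod>v\<in>Poly_Mapping.keys m. x v ^ Poly_Mapping.lookup m v)"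

lemma monom_eval_superset:
  assumes "finite S" "Poly_Mapping.keys m \<subseteq> S"
  shows "monom_eval m x = (\<Prod>v\<in>S. x v ^ Poly_Mapping.lookup m v)"
  unfolding monom_eval_def
  by (rule prod.mono_neutral_left) (use assms in \<open>auto simp: in_keys_iff\<close>)

lemma monom_eval_zero [simp]: "monom_eval 0 x = 1"
  by (simp add: monom_eval_def)

lemma monom_eval_single [simp]: "monom_eval (Poly_Mapping.single v k) x = x v ^ k"
  by (cases "k = 0") (auto simp: monom_eval_def)

lemma monom_eval_add: "monom_eval (m + n) x = monom_eval m x * monom_eval n x"
proof -
  let ?S = "Poly_Mapping.keys m \<union> Poly_Mapping.keys n"
  have "monom_eval (m + n) x = (\<Prod>v\<in>?S. x v ^ Poly_Mapping.lookup (m + n) v)"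
    by (rule monom_eval_superset) (auto simp: Poly_Mapping.keys_add)
  also have "\<dots> = (\<Prod>v\<in>?S. x v ^ Poly_Mapping.lookup m v) * (\<Prod>v\<in>?S. x v ^ Poly_Mapping.lookup n v)"
    by (simp add: lookup_add power_add prod.distrib)
  also have "\<dots> = monom_eval m x * monom_eval n x"
    by (simp flip: monom_eval_superset)
  finally show ?thesis .
qed

lemma mpoly_eval_superset:
  assumes "finite S" "Poly_Mapping.keys p \<subseteq> S"
  shows "mpoly_eval p x = (\<Sum>m\<in>S. Poly_Mapping.lookup p m * monom_eval m x)"
  unfolding mpoly_eval_def monom_eval_def
  by (rule sum.mono_neutral_left) (use assms in \<open>auto simp: in_keys_iff\<close>)

lemma mpoly_eval_conv_monom_eval:
  "mpoly_eval p x = (\<Sum>m\<in>Poly_Mapping.keys p. Poly_Mapping.lookup p m * monom_eval m x)"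
  by (simp add: mpoly_eval_def monom_eval_def)

lemma mpoly_eval_zero [simp]: "mpoly_eval 0 x = 0"
  by (simp add: mpoly_eval_def)

lemma mpoly_eval_single [simp]:
  "mpoly_eval (Poly_Mapping.single m c) x = c * monom_eval m x"
  by (cases "c = 0") (auto simp: mpoly_eval_conv_monom_eval)

lemma mpoly_eval_one [simp]: "mpoly_eval 1 x = 1"
  by (metis mpoly_eval_single single_one monom_eval_zero mult_1)

lemma mpoly_eval_add: "mpoly_eval (p + q) x = mpoly_eval p x + mpoly_eval q x"
proof -
  let ?S = "Poly_Mapping.keys p \<union> Poly_Mapping.keys q"
  have "mpoly_eval (p + q) x = (\<Sum>m\<in>?S. Poly_Mapping.lookup (p + q) m * monom_eval m x)"
    by (rule mpoly_eval_superset) (auto simp: Poly_Mapping.keys_add)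
  also have "\<dots> = (\<Sum>m\<in>?S. Poly_Mapping.lookup p m * monom_eval m x)
      + (\<Sum>m\<in>?S. Poly_Mapping.lookup q m * monom_eval m x)"
    by (simp add: lookup_add distrib_right sum.distrib)
  also have "\<dots> = mpoly_eval p x + mpoly_eval q x"
    by (simp flip: mpoly_eval_superset)
  finally show ?thesis .
qed

lemma mpoly_eval_diff: "mpoly_eval (p - q) x = mpoly_eval p x - mpoly_eval q x"
  for p :: "('v, 'a::comm_ring_1) mpoly"
  using mpoly_eval_add [of "p - q" q x] by simp

lemma mpoly_eval_sum: "mpoly_eval (\<Sum>i\<in>S. f i) x = (\<Sum>i\<in>S. mpoly_eval (f i) x)"
  by (induction S rule: infinite_finite_induct) (auto simp: mpoly_eval_add)

lemma poly_mapping_eq_sum_single: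
  "p = (\<Sum>m\<in>Poly_Mapping.keys p. Poly_Mapping.single m (Poly_Mapping.lookup p m))"
  by (rule poly_mapping_eqI) (auto simp: lookup_sum lookup_single when_def sum.delta in_keys_iff)

lemma mpoly_eval_mult: "mpoly_eval (p * q) x = mpoly_eval p x * mpoly_eval q x"
proof -
  have "p * q = (\<Sum>m\<in>Poly_Mapping.keys p. Poly_Mapping.single m (Poly_Mapping.lookup p m))
      * (\<Sum>m\<in>Poly_Mapping.keys q. Poly_Mapping.single m (Poly_Mapping.lookup q m))"
    using poly_mapping_eq_sum_single [of p] poly_mapping_eq_sum_single [of q] by argo
  also have "mpoly_eval \<dots> x = mpoly_eval p x * mpoly_eval q x"
    unfolding mpoly_eval_conv_monom_eval [of p] mpoly_eval_conv_monom_eval [of q]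
    by (simp add: sum_product mult_single mpoly_eval_sum monom_eval_add mult_ac)
  finally show ?thesis .
qed

lemma mpoly_eval_prod: "mpoly_eval (\<Prod>i\<in>S. f i) x = (\<Prod>i\<in>S. mpoly_eval (f i) x)"
  by (induction S rule: infinite_finite_induct) (auto simp: mpoly_eval_mult)

lemma mpoly_eval_power: "mpoly_eval (p ^ k) x = mpoly_eval p x ^ k"
  by (induction k) (auto simp: mpoly_eval_mult)

section \<open>Complexification and real parts of polynomials\<close>

lemma monom_eval_hom:
  assumes "\<And>v. f (x v) = y v" "f 1 = 1" "\<And>s t. f (s * t) = f s * f t"
  shows "f (monom_eval m x) = monom_eval m y"
proof -
  have pow: "f (s ^ k) = f s ^ k" for s k
    by (induction k) (auto simp: assms)
  have "f (\<Prod>v\<in>S. x v ^ Poly_Mapping.lookup m v) = (\<Prod>v\<in>S. y v ^ Poly_Mapping.lookup m v)" for S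
    by (induction S rule: infinite_finite_induct) (auto simp: assms pow)
  then show ?thesis
    by (simp add: monom_eval_def)
qed

lemma mpoly_eval_complexify:
  "mpoly_eval (complexify p) (\<lambda>v. complex_of_real (x v)) = complex_of_real (mpoly_eval p x)"
proof -
  have keys: "Poly_Mapping.keys (complexify p) = Poly_Mapping.keys p"
    by (auto simp: in_keys_iff Poly_Mapping.map.rep_eq when_def)
  have "monom_eval m (\<lambda>v. complex_of_real (x v)) = complex_of_real (monom_eval m x)" for m
    by (rule monom_eval_hom [symmetric]) auto
  then show ?thesis
    by (simp add: mpoly_eval_conv_monom_eval keys Poly_Mapping.map.rep_eq when_def in_keys_iff)
qed

text \<open>Every monomial of \<open>G\<close> takes a real value at \<open>c x\<close>, so only the
  real parts of the coefficients contribute. This later turns an inverse map with complex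
  coefficients into real polynomials.\<close>

lemma ex_mpoly_Re_eval:
  fixes G :: "('j, complex) mpoly"
  assumes "\<And>j. \<exists>r :: ('v, real) mpoly. \<forall>x. c x j = complex_of_real (mpoly_eval r x)"
  shows "\<exists>r :: ('v, real) mpoly. \<forall>x. mpoly_eval r x = Re (mpoly_eval G (c x))"
proof -
  obtain r :: "'j \<Rightarrow> ('v, real) mpoly" where r: "\<And>x j. c x j = complex_of_real (mpoly_eval (r j) x)"
    using assms by metis
  define R where "R = (\<Sum>m\<in>Poly_Mapping.keys G. Poly_Mapping.single 0 (Re (Poly_Mapping.lookup G m))
    * (\<Prod>j\<in>Poly_Mapping.keys m. r j ^ Poly_Mapping.lookup m j))"
  have "mpoly_eval R x = Re (mpoly_eval G (c x))" for x
  proof -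
    have "monom_eval m (c x)
        = complex_of_real (\<Prod>j\<in>Poly_Mapping.keys m. mpoly_eval (r j) x ^ Poly_Mapping.lookup m j)" for m
      by (simp add: monom_eval_def r)
    then show ?thesis
      by (simp add: R_def mpoly_eval_sum mpoly_eval_mult mpoly_eval_prod mpoly_eval_power
          mpoly_eval_conv_monom_eval [of G] del: of_real_prod of_real_power)
  qed
  then show ?thesis by blast
qed

text \<open>Finitely many nonzero polynomials have finitely many roots in all. The number
  \<open>T\<close> serves as the base of the substitution in
  \<open>mpoly_nonzero_eval\<close>.\<close>

lemma ex_nat_avoiding_roots:
  fixes P :: "'i \<Rightarrow> int poly"
  assumes "finite S" "\<And>i. i \<in> S \<Longrightarrow> P i \<noteq> 0"
  shows "\<exists>T :: nat. \<forall>i\<in>S. poly (P i) (int T) \<noteq> 0"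
proof -
  have "finite (\<Union>i\<in>S. {t. poly (P i) t = 0})"
    using assms by (auto intro: poly_roots_finite)
  then have "finite {T. int T \<in> (\<Union>i\<in>S. {t. poly (P i) t = 0})}"
    by (rule finite_inverse_image) (simp add: inj_on_def)
  then obtain T where "T \<notin> {T. int T \<in> (\<Union>i\<in>S. {t. poly (P i) t = 0})}"
    using ex_new_if_finite infinite_UNIV_nat by blast
  then show ?thesis by blast
qed

text \<open>
  For an injection \<open>e\<close> of the variables into the natural numbers and all but finitely many \<open>T\<close>, the
  substitution of \<open>t\<close> to the power \<open>T ^ e v\<close> for \<open>v\<close> sends the distinct monomials of \<open>p\<close> to distinct
  powers of \<open>t\<close>.
\<close>

lemma mpoly_nonzero_eval:
  fixes p :: "('v::finite, 'a::{idom, ring_char_0}) mpoly"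
  assumes "p \<noteq> 0"
  shows "\<exists>x. mpoly_eval p x \<noteq> 0"
proof -
  let ?K = "Poly_Mapping.keys p"
  define e :: "'v \<Rightarrow> nat" where "e = to_nat"
  have e: "e v = e w \<longleftrightarrow> v = w" for v w
    by (simp add: e_def)
  \<comment> \<open>The value of \<open>P m n\<close> at \<open>T\<close> is the difference of the
    powers of \<open>t\<close> assigned to \<open>m\<close> and \<open>n\<close>, so a non-root
    \<open>T\<close> keeps the two monomials apart.\<close>
  define P :: "('v \<Rightarrow>\<^sub>0 nat) \<Rightarrow> ('v \<Rightarrow>\<^sub>0 nat) \<Rightarrow> int poly"
    where "P m n = (\<Sum>v\<in>UNIV. Polynomial.monom
      (int (Poly_Mapping.lookup m v) - int (Poly_Mapping.lookup n v)) (e v))" for m n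
  have P: "P m n \<noteq> 0" if neq: "m \<noteq> n" for m n
  proof -
    obtain v where v: "Poly_Mapping.lookup m v \<noteq> Poly_Mapping.lookup n v"
      using neq by (auto simp: poly_mapping_eq_iff fun_eq_iff)
    have "poly.coeff (P m n) (e v)
        = (\<Sum>w\<in>UNIV. if w = v then int (Poly_Mapping.lookup m w) - int (Poly_Mapping.lookup n w) else 0)"
      unfolding P_def by (auto simp: coeff_sum e intro!: sum.cong)
    with v show ?thesis by auto
  qed
  have "\<exists>T :: nat. \<forall>i\<in>{(m, n). m \<in> ?K \<and> n \<in> ?K \<and> m \<noteq> n}. poly (case_prod P i) (int T) \<noteq> 0"
    by (rule ex_nat_avoiding_roots)
      (use P in \<open>auto intro: finite_subset [of _ "?K \<times> ?K"]\<close>)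
  then obtain T :: nat where T: "\<And>m n. m \<in> ?K \<Longrightarrow> n \<in> ?K \<Longrightarrow> m \<noteq> n \<Longrightarrow> poly (P m n) (int T) \<noteq> 0"
    by auto
  define w where "w m = (\<Sum>v\<in>UNIV. T ^ e v * Poly_Mapping.lookup m v)" for m
  have w: "m = n" if "m \<in> ?K" "n \<in> ?K" "w m = w n" for m n
  proof (rule ccontr)
    assume "m \<noteq> n"
    then have "poly (P m n) (int T) \<noteq> 0" using T that by blast
    moreover have "poly (P m n) (int T) = int (w m) - int (w n)"
      by (simp add: P_def w_def poly_sum poly_monom algebra_simps sum_subtractf)
    ultimately show False using that by simp
  qed
  define q where "q = (\<Sum>m\<in>?K. Polynomial.monom (Poly_Mapping.lookup p m) (w m))"
  have q: "poly q t = mpoly_eval p (\<lambda>v. t ^ T ^ e v)" for t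
  proof -
    have "monom_eval m (\<lambda>v. t ^ T ^ e v) = t ^ w m" for m
      by (subst monom_eval_superset [of UNIV])
        (auto simp: w_def power_sum power_mult)
    then show ?thesis
      by (simp add: q_def poly_sum poly_monom mpoly_eval_conv_monom_eval)
  qed
  obtain m where m: "m \<in> ?K"
    using assms by (auto simp: poly_mapping_eq_iff fun_eq_iff in_keys_iff)
  \<comment> \<open>As \<open>w\<close> is injective on the monomials of \<open>p\<close>, no two
    terms of \<open>q\<close> can cancel.\<close>
  have "poly.coeff q (w m) = (\<Sum>n\<in>?K. if n = m then Poly_Mapping.lookup p n else 0)"
    unfolding q_def coeff_sum by (rule sum.cong) (use w m in auto)
  with m have "q \<noteq> 0" by (auto simp: in_keys_iff)
  then obtain t where "poly q t \<noteq> 0"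
    using poly_all_0_iff_0 by blast
  then show ?thesis using q by auto
qed

section \<open>Functions that are polynomial along lines\<close>

text \<open>A condition on functions rather than on polynomials: it passes directly through sums,
  products and compositions, and it reduces vanishing arguments to roots of univariate
  polynomials.\<close>

definition line_poly :: "(('v \<Rightarrow> 'a::comm_ring_1) \<Rightarrow> 'a) \<Rightarrow> bool" where
  "line_poly f \<longleftrightarrow> (\<forall>x y. \<exists>p. \<forall>t. f (\<lambda>v. x v + t * y v) = poly p t)"

lemma line_polyI:
  assumes "\<And>x y. \<exists>p. \<forall>t. f (\<lambda>v. x v + t * y v) = poly p t"
  shows "line_poly f"
  using assms by (simp add: line_poly_def)

lemma line_polyE:
  assumes "line_poly f"
  obtains p where "\<And>t. f (\<lambda>v. x v + t * y v) = poly p t"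
  using assms unfolding line_poly_def by metis

lemma line_poly_const [simp]: "line_poly (\<lambda>x. c)"
  by (rule line_polyI, rule exI [of _ "[:c:]"]) simp

lemma line_poly_coord [simp]: "line_poly (\<lambda>x. x v)"
proof (rule line_polyI)
  fix x y :: "'a \<Rightarrow> 'b"
  show "\<exists>p. \<forall>t. x v + t * y v = poly p t"
    by (rule exI [of _ "[:x v, y v:]"]) simp
qed

lemma line_poly_add [simp]:
  assumes "line_poly f" "line_poly g"
  shows "line_poly (\<lambda>x. f x + g x)"
proof (rule line_polyI)
  fix x y
  obtain p q where "\<And>t. f (\<lambda>v. x v + t * y v) = poly p t" "\<And>t. g (\<lambda>v. x v + t * y v) = poly q t"
    using assms by (metis line_polyE)
  then show "\<exists>p. \<forall>t. f (\<lambda>v. x v + t * y v) + g (\<lambda>v. x v + t * y v) = poly p t"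
    by (metis poly_add)
qed

lemma line_poly_mult [simp]:
  assumes "line_poly f" "line_poly g"
  shows "line_poly (\<lambda>x. f x * g x)"
proof (rule line_polyI)
  fix x y
  obtain p q where "\<And>t. f (\<lambda>v. x v + t * y v) = poly p t" "\<And>t. g (\<lambda>v. x v + t * y v) = poly q t"
    using assms by (metis line_polyE)
  then show "\<exists>p. \<forall>t. f (\<lambda>v. x v + t * y v) * g (\<lambda>v. x v + t * y v) = poly p t"
    by (metis poly_mult)
qed

lemma line_poly_sum [simp]:
  assumes "\<And>i. i \<in> S \<Longrightarrow> line_poly (f i)"
  shows "line_poly (\<lambda>x. \<Sum>i\<in>S. f i x)"
  using assms by (induction S rule: infinite_finite_induct) auto

lemma line_poly_prod [simp]:
  assumes "\<And>i. i \<in> S \<Longrightarrow> line_poly (f i)"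
  shows "line_poly (\<lambda>x. \<Prod>i\<in>S. f i x)"
  using assms by (induction S rule: infinite_finite_induct) auto

lemma line_poly_power [simp]: "line_poly f \<Longrightarrow> line_poly (\<lambda>x. f x ^ k)"
  by (induction k) auto

lemma line_poly_mpoly_eval [simp]:
  assumes "\<And>v. line_poly (\<lambda>x. c x v)"
  shows "line_poly (\<lambda>x. mpoly_eval p (c x))"
  unfolding mpoly_eval_def using assms by simp

lemma line_poly_eval [simp]: "line_poly (mpoly_eval p)"
  by (rule line_poly_mpoly_eval) simp

text \<open>Along \<open>x + t (y - x)\<close> one restriction is nonzero at \<open>t = 0\<close>,
  the other at \<open>t = 1\<close>, so their product is a nonzero univariate polynomial and has a
  non-root. This plays the part of the irreducibility of affine space.\<close>

lemma line_poly_common_nonzero: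
  fixes f g :: "('v \<Rightarrow> 'a::{idom, ring_char_0}) \<Rightarrow> 'a"
  assumes "line_poly f" "line_poly g" "f x \<noteq> 0" "g y \<noteq> 0"
  shows "\<exists>z. f z \<noteq> 0 \<and> g z \<noteq> 0"
proof -
  let ?l = "\<lambda>t v. x v + t * (y v - x v)"
  obtain p where p: "\<And>t. f (?l t) = poly p t"
    using line_polyE [OF assms(1), of x "\<lambda>v. y v - x v"] by blast
  obtain q where q: "\<And>t. g (?l t) = poly q t"
    using line_polyE [OF assms(2), of x "\<lambda>v. y v - x v"] by blast
  have "poly p 0 \<noteq> 0" "poly q 1 \<noteq> 0"
    using assms p [of 0] q [of 1] by auto
  then have "p * q \<noteq> 0" by auto
  then obtain t where "poly (p * q) t \<noteq> 0"
    using poly_all_0_iff_0 by blast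
  then have "f (?l t) \<noteq> 0 \<and> g (?l t) \<noteq> 0" using p q by simp
  then show ?thesis by blast
qed

text \<open>
  A complex point is \<open>x + \<i> y\<close> with real \<open>x\<close> and \<open>y\<close>, so it lies on the complexification of a
  real line.
\<close>

lemma line_poly_eq_zero:
  fixes f :: "('n::finite \<Rightarrow> complex) \<Rightarrow> complex" and U :: "(real ^ 'n) set"
  assumes f: "line_poly f"
    and U: "interior U \<noteq> {}"
    and zero: "\<And>x. x \<in> U \<Longrightarrow> f (\<lambda>i. complex_of_real (x $ i)) = 0"
  shows "f z = 0"
proof -
  have poly0: "p = 0" if "infinite S" "\<And>t. t \<in> S \<Longrightarrow> poly p (complex_of_real t) = 0" for p S
  proof (rule ccontr)
    assume "p \<noteq> 0"
    then have "finite {t. poly p t = 0}" by (rule poly_roots_finite)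
    moreover have "complex_of_real ` S \<subseteq> {t. poly p t = 0}" using that by auto
    ultimately have "finite (complex_of_real ` S)" by (rule finite_subset [rotated])
    then show False using that(1) by (simp add: finite_image_iff inj_on_def)
  qed
  obtain u where u: "u \<in> interior U" using U by blast
  have real: "f (\<lambda>i. complex_of_real (x i)) = 0" for x :: "'n \<Rightarrow> real"
  proof -
    define d where "d = (\<chi> i. x i) - u"
    obtain p where p: "\<And>t. f (\<lambda>i. complex_of_real (u $ i) + t * complex_of_real (d $ i)) = poly p t"
      using line_polyE [OF f, of "\<lambda>i. complex_of_real (u $ i)" "\<lambda>i. complex_of_real (d $ i)"] by blast
    \<comment> \<open>These are the parameters at which the line from \<open>u\<close> towards
      \<open>x\<close> stays in the interior of \<open>U\<close>; a nonempty open set of reals is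
      infinite.\<close>
    let ?S = "(\<lambda>t. u + t *\<^sub>R d) -` interior U"
    have "open ?S"
      by (rule open_vimage) (auto intro!: continuous_intros)
    moreover have "0 \<in> ?S" using u by simp
    ultimately have "infinite ?S"
      using finite_imp_not_open by blast
    moreover have "poly p (complex_of_real t) = 0" if "t \<in> ?S" for t
      using zero [of "u + t *\<^sub>R d"] that interior_subset p [of "complex_of_real t"] by auto
    ultimately have "p = 0" by (rule poly0)
    then show ?thesis using p [of 1] by (simp add: d_def)
  qed
  obtain p where p: "\<And>t. f (\<lambda>i. complex_of_real (Re (z i)) + t * complex_of_real (Im (z i))) = poly p t"
    using line_polyE [OF f, of "\<lambda>i. complex_of_real (Re (z i))" "\<lambda>i. complex_of_real (Im (z i))"] by blast
  have "poly p (complex_of_real t) = 0" for t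
    using real [of "\<lambda>i. Re (z i) + t * Im (z i)"] p [of "complex_of_real t"] by simp
  then have "p = 0"
    by (intro poly0 [of UNIV]) (auto simp: infinite_UNIV_char_0)
  then show ?thesis
    using p [of \<i>] by (simp flip: complex_eq)
qed

section \<open>Density of the set where a polynomial does not vanish\<close>

lemma continuous_on_mpoly_eval [continuous_intros]:
  fixes c :: "'b::topological_space \<Rightarrow> 'v \<Rightarrow> 'a::{real_normed_algebra, comm_ring_1}"
  assumes "\<And>v. continuous_on S (\<lambda>x. c x v)"
  shows "continuous_on S (\<lambda>x. mpoly_eval p (c x))"
  unfolding mpoly_eval_def using assms by (intro continuous_intros) auto

lemma ex_mpoly_eval_nonzero:
  fixes q :: "('n::finite, real) mpoly" and K :: "(real ^ 'n) set"
  assumes "q \<noteq> 0" "interior K \<noteq> {}"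
  shows "\<exists>x\<in>K. mpoly_eval q (($) x) \<noteq> 0"
proof (rule ccontr)
  assume "\<not> ?thesis"
  then have zero: "mpoly_eval q (($) x) = 0" if "x \<in> K" for x
    using that by blast
  obtain y where y: "mpoly_eval q y \<noteq> 0"
    using mpoly_nonzero_eval [OF assms(1)] by blast
  have "mpoly_eval (complexify q) (\<lambda>i. complex_of_real (y i)) = 0"
    by (rule line_poly_eq_zero [OF _ assms(2), of "mpoly_eval (complexify q)"])
      (auto simp: mpoly_eval_complexify zero)
  with y show False by (simp add: mpoly_eval_complexify)
qed

text \<open>On the segment from \<open>x\<close> to a point \<open>u\<close> of \<open>K\<close>
  with nonzero value, the polynomial has finitely many zeros, so points with nonzero value come
  arbitrarily close to \<open>x\<close>.\<close>

lemma closure_mpoly_nonzero: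
  fixes q :: "('n::finite, real) mpoly" and K :: "(real ^ 'n) set"
  assumes "q \<noteq> 0" "convex K" "interior K \<noteq> {}"
  shows "K \<subseteq> closure {x \<in> K. mpoly_eval q (($) x) \<noteq> 0}"
proof
  fix x assume x: "x \<in> K"
  obtain u where u: "u \<in> K" "mpoly_eval q (($) u) \<noteq> 0"
    using ex_mpoly_eval_nonzero assms by blast
  obtain p where p: "\<And>t. mpoly_eval q (\<lambda>i. x $ i + t * (u - x) $ i) = poly p t"
    by (rule line_polyE [of "mpoly_eval q" "($) x" "($) (u - x)"]) auto
  have pq: "poly p t = mpoly_eval q (($) (x + t *\<^sub>R (u - x)))" for t
  proof -
    have "($) (x + t *\<^sub>R (u - x)) = (\<lambda>i. x $ i + t * (u - x) $ i)"
      by (simp add: fun_eq_iff)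
    with p [of t] show ?thesis by simp
  qed
  have "poly p 1 \<noteq> 0" using pq u by simp
  then have fin: "finite {t. poly p t = 0}" by (metis poly_0 poly_roots_finite)
  show "x \<in> closure {x \<in> K. mpoly_eval q (($) x) \<noteq> 0}"
    unfolding closure_approachable
  proof (intro allI impI)
    fix e :: real assume e: "0 < e"
    \<comment> \<open>The bound 1 keeps the point on the segment, the quotient keeps it within
      distance \<open>e\<close>; adding 1 to the norm covers the case \<open>u = x\<close>.\<close>
    define \<delta> where "\<delta> = min 1 (e / (norm (u - x) + 1))"
    have "0 < \<delta>" using e by (simp add: \<delta>_def add_nonneg_pos)
    then have "\<not> {0<..<\<delta>} \<subseteq> {t. poly p t = 0}"
      using fin infinite_Ioo finite_subset by blast
    then obtain t where "t \<in> {0<..<\<delta>}" and pt: "poly p t \<noteq> 0" by blast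
    then have t: "0 < t" "t < \<delta>" by auto
    have "x + t *\<^sub>R (u - x) = (1 - t) *\<^sub>R x + t *\<^sub>R u" by (simp add: algebra_simps)
    then have "x + t *\<^sub>R (u - x) \<in> K"
      using assms(2) x u t by (auto simp: \<delta>_def intro: convexD_alt)
    moreover have "dist (x + t *\<^sub>R (u - x)) x < e"
    proof -
      have "t * norm (u - x) \<le> t * (norm (u - x) + 1)" using t by simp
      also have "\<dots> < e"
        using t e by (simp add: \<delta>_def pos_less_divide_eq add_nonneg_pos)
      finally show ?thesis using t by (simp add: dist_norm)
    qed
    ultimately show "\<exists>y\<in>{x \<in> K. mpoly_eval q (($) x) \<noteq> 0}. dist y x < e"
      using pt pq by auto
  qed
qed

text \<open>Continuous functions that agree on a dense set agree. This carries identities across the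
  zeros of denominators.\<close>

lemma eq_on_if_eq_where_mpoly_nonzero:
  fixes q :: "('n::finite, real) mpoly" and K :: "(real ^ 'n) set"
    and f g :: "real ^ 'n \<Rightarrow> 'b::real_normed_vector"
  assumes "q \<noteq> 0" "convex K" "closed K" "interior K \<noteq> {}"
    and cont: "continuous_on K f" "continuous_on K g"
    and eq: "\<And>x. x \<in> K \<Longrightarrow> mpoly_eval q (($) x) \<noteq> 0 \<Longrightarrow> f x = g x"
    and x: "x \<in> K"
  shows "f x = g x"
proof -
  let ?S = "{x \<in> K. mpoly_eval q (($) x) \<noteq> 0}"
  have S: "closure ?S \<subseteq> K"
    using assms(3) by (intro closure_minimal) auto
  have "f x - g x = 0"
    by (rule continuous_constant_on_closure [of ?S "\<lambda>x. f x - g x"])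
      (use closure_mpoly_nonzero [OF assms(1,2,4)] x eq S in
        \<open>auto intro!: continuous_intros continuous_on_subset [OF cont(1)] continuous_on_subset [OF cont(2)]\<close>)
  then show ?thesis by simp
qed

section \<open>Forms\<close>

definition total_degree :: "('v \<Rightarrow>\<^sub>0 nat) \<Rightarrow> nat" where
  "total_degree m = (\<Sum>v\<in>Poly_Mapping.keys m. Poly_Mapping.lookup m v)"

lemma total_degree_superset:
  assumes "finite S" "Poly_Mapping.keys m \<subseteq> S"
  shows "total_degree m = (\<Sum>v\<in>S. Poly_Mapping.lookup m v)"
  unfolding total_degree_def
  by (rule sum.mono_neutral_left) (use assms in \<open>auto simp: in_keys_iff\<close>)

lemma total_degree_add: "total_degree (m + n) = total_degree m + total_degree n"
proof -
  let ?S = "Poly_Mapping.keys m \<union> Poly_Mapping.keys n"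
  have "total_degree (m + n) = (\<Sum>v\<in>?S. Poly_Mapping.lookup (m + n) v)"
    by (rule total_degree_superset) (auto simp: Poly_Mapping.keys_add)
  also have "\<dots> = total_degree m + total_degree n"
    by (simp add: lookup_add sum.distrib flip: total_degree_superset)
  finally show ?thesis .
qed

lemma forms_iff:
  "p \<in> forms I k \<longleftrightarrow> (\<forall>m\<in>Poly_Mapping.keys p. Poly_Mapping.keys m \<subseteq> I \<and> total_degree m = k)"
  by (simp add: forms_def total_degree_def)

lemma forms_zero [simp]: "0 \<in> forms I k"
  by (simp add: forms_iff)

lemma forms_const [simp]: "Poly_Mapping.single 0 c \<in> forms I 0"
  by (auto simp: forms_iff total_degree_def)

lemma forms_one [simp]: "1 \<in> forms I 0"
  by (metis forms_const single_one)

lemma forms_var [simp]: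
  "v \<in> I \<Longrightarrow> Poly_Mapping.single (Poly_Mapping.single v 1) c \<in> forms I 1"
  by (auto simp: forms_iff total_degree_def)

lemma forms_add: "p \<in> forms I k \<Longrightarrow> q \<in> forms I k \<Longrightarrow> p + q \<in> forms I k"
  using Poly_Mapping.keys_add [of p q] by (auto simp: forms_iff)

lemma forms_uminus: "p \<in> forms I k \<Longrightarrow> - p \<in> forms I k"
  for p :: "('v, 'a::comm_ring_1) mpoly"
  by (auto simp: forms_iff in_keys_iff)

lemma forms_diff: "p \<in> forms I k \<Longrightarrow> q \<in> forms I k \<Longrightarrow> p - q \<in> forms I k"
  for p :: "('v, 'a::comm_ring_1) mpoly"
  using forms_add [of p I k "- q"] by (simp add: forms_uminus)

lemma forms_sum: "(\<And>i. i \<in> S \<Longrightarrow> f i \<in> forms I k) \<Longrightarrow> (\<Sum>i\<in>S. f i) \<in> forms I k"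
  by (induction S rule: infinite_finite_induct) (auto simp: forms_add)

lemma forms_mult:
  assumes "p \<in> forms I k" "q \<in> forms I l"
  shows "p * q \<in> forms I (k + l)"
  unfolding forms_iff
proof
  fix m assume "m \<in> Poly_Mapping.keys (p * q)"
  then obtain s t where "s \<in> Poly_Mapping.keys p" "t \<in> Poly_Mapping.keys q" "m = s + t"
    using Poly_Mapping.keys_mult [of p q] by blast
  moreover from this have "Poly_Mapping.keys s \<union> Poly_Mapping.keys t \<subseteq> I"
      "total_degree s = k" "total_degree t = l"
    using assms by (auto simp: forms_iff)
  ultimately show "Poly_Mapping.keys m \<subseteq> I \<and> total_degree m = k + l"
    using Poly_Mapping.keys_add [of s t] by (auto simp: total_degree_add)
qed

lemma forms_power: "p \<in> forms I k \<Longrightarrow> p ^ n \<in> forms I (n * k)"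
  by (induction n) (auto intro: forms_mult)

lemma forms_prod:
  "(\<And>i. i \<in> S \<Longrightarrow> f i \<in> forms I (k i)) \<Longrightarrow> (\<Prod>i\<in>S. f i) \<in> forms I (\<Sum>i\<in>S. k i)"
  by (induction S rule: infinite_finite_induct) (auto intro: forms_mult)

text \<open>Composition multiplies degrees. It serves to compose the projection, its inverse and the
  equations of the variety.\<close>

lemma ex_form_subst:
  assumes F: "F \<in> forms J k" and f: "\<And>j. j \<in> J \<Longrightarrow> f j \<in> forms I l"
  shows "\<exists>r\<in>forms I (k * l). \<forall>y. mpoly_eval r y = mpoly_eval F (\<lambda>j. mpoly_eval (f j) y)"
proof
  let ?t = "\<lambda>m. Poly_Mapping.single 0 (Poly_Mapping.lookup F m)
    * (\<Prod>v\<in>Poly_Mapping.keys m. f v ^ Poly_Mapping.lookup m v)"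
  let ?r = "\<Sum>m\<in>Poly_Mapping.keys F. ?t m"
  show "?r \<in> forms I (k * l)"
  proof (rule forms_sum)
    fix m assume "m \<in> Poly_Mapping.keys F"
    then have m: "Poly_Mapping.keys m \<subseteq> J" "total_degree m = k"
      using F by (auto simp: forms_iff)
    have "?t m \<in> forms I (0 + (\<Sum>v\<in>Poly_Mapping.keys m. Poly_Mapping.lookup m v * l))"
      using m f by (intro forms_mult forms_prod forms_power) auto
    then show "?t m \<in> forms I (k * l)"
      using m by (simp add: total_degree_def flip: sum_distrib_right)
  qed
  show "\<forall>y. mpoly_eval ?r y = mpoly_eval F (\<lambda>j. mpoly_eval (f j) y)"
    by (simp add: mpoly_eval_sum mpoly_eval_mult mpoly_eval_prod mpoly_eval_power
        mpoly_eval_conv_monom_eval [of F] monom_eval_def)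
qed

lemma forms_eval_scale:
  assumes "F \<in> forms I k"
  shows "mpoly_eval F (\<lambda>i. c * y i) = c ^ k * mpoly_eval F y"
proof -
  have "monom_eval m (\<lambda>i. c * y i) = c ^ k * monom_eval m y" if "m \<in> Poly_Mapping.keys F" for m
    using assms that
    by (auto simp: forms_iff total_degree_def monom_eval_def power_mult_distrib prod.distrib power_sum)
  then show ?thesis
    by (simp add: mpoly_eval_conv_monom_eval sum_distrib_left mult_ac)
qed

section \<open>Homogenization and the affine chart\<close>

abbreviation affine_coord :: "('n \<Rightarrow> 'a::one) \<Rightarrow> 'n option \<Rightarrow> 'a" where
  "affine_coord z \<equiv> case_option 1 z"

text \<open>Each monomial is padded to degree \<open>N\<close> by a power of the coordinate
  \<open>None\<close>. Since \<open>N\<close> is any bound on the degrees, several polynomials can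
  be given a common degree.\<close>

lemma ex_homogenization:
  fixes p :: "('n, 'a::comm_ring_1) mpoly"
  assumes "\<And>m. m \<in> Poly_Mapping.keys p \<Longrightarrow> total_degree m \<le> N"
  shows "\<exists>G\<in>forms UNIV N. \<forall>z. mpoly_eval G (affine_coord z) = mpoly_eval p z"
proof
  define X :: "'n option \<Rightarrow> ('n option, 'a) mpoly"
    where "X j = Poly_Mapping.single (Poly_Mapping.single j 1) 1" for j
  have X: "X j \<in> forms UNIV 1" "mpoly_eval (X j) y = y j" for j y
    by (auto simp: X_def simp del: One_nat_def)
  let ?t = "\<lambda>m. Poly_Mapping.single 0 (Poly_Mapping.lookup p m)
    * (\<Prod>v\<in>Poly_Mapping.keys m. X (Some v) ^ Poly_Mapping.lookup m v) * X None ^ (N - total_degree m)"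
  let ?G = "\<Sum>m\<in>Poly_Mapping.keys p. ?t m"
  show "?G \<in> forms UNIV N"
  proof (rule forms_sum)
    fix m assume m: "m \<in> Poly_Mapping.keys p"
    have "?t m \<in> forms UNIV (0 + (\<Sum>v\<in>Poly_Mapping.keys m. Poly_Mapping.lookup m v * 1)
        + (N - total_degree m) * 1)"
      by (intro forms_mult forms_prod forms_power X forms_const)
    then show "?t m \<in> forms UNIV N"
      using assms [OF m] by (simp flip: total_degree_def)
  qed
  show "\<forall>z. mpoly_eval ?G (affine_coord z) = mpoly_eval p z"
    by (simp add: mpoly_eval_sum mpoly_eval_mult mpoly_eval_prod mpoly_eval_power X
        mpoly_eval_conv_monom_eval [of p] monom_eval_def)
qed

lemma ex_common_homogenization:
  fixes g :: "'i \<Rightarrow> ('n, 'a::comm_ring_1) mpoly"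
  assumes "finite A"
  shows "\<exists>N G. \<forall>a\<in>A. G a \<in> forms UNIV N \<and>
    (\<forall>z. mpoly_eval (G a) (affine_coord z) = mpoly_eval (g a) z)"
proof -
  define M where "M = (\<Union>a\<in>A. Poly_Mapping.keys (g a))"
  have "finite M" using assms by (simp add: M_def)
  \<comment> \<open>The sum over all occurring monomials is a crude common bound for their
    degrees.\<close>
  then have deg: "total_degree m \<le> (\<Sum>m\<in>M. total_degree m)" if "m \<in> M" for m
    using that by (simp add: member_le_sum)
  have "\<exists>G. \<forall>a\<in>A. G a \<in> forms UNIV (\<Sum>m\<in>M. total_degree m) \<and>
      (\<forall>z. mpoly_eval (G a) (affine_coord z) = mpoly_eval (g a) z)"
  proof (intro bchoice ballI)
    fix a assume "a \<in> A"
    then have "total_degree m \<le> (\<Sum>m\<in>M. total_degree m)" if "m \<in> Poly_Mapping.keys (g a)" for m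
      using that by (intro deg) (auto simp: M_def)
    then show "\<exists>G. G \<in> forms UNIV (\<Sum>m\<in>M. total_degree m) \<and>
        (\<forall>z. mpoly_eval G (affine_coord z) = mpoly_eval (g a) z)"
      using ex_homogenization by (metis (no_types, lifting))
  qed
  then show ?thesis by blast
qed

lemma forms_eval_affine_coord:
  fixes G :: "('n option, 'a::field) mpoly"
  assumes "G \<in> forms I k" "w None \<noteq> 0"
  shows "mpoly_eval G w = w None ^ k * mpoly_eval G (affine_coord (\<lambda>i. w (Some i) / w None))"
proof -
  have "w = (\<lambda>j. w None * affine_coord (\<lambda>i. w (Some i) / w None) j)"
    using assms by (auto simp: fun_eq_iff split: option.split)
  then show ?thesis
    using forms_eval_scale [OF assms(1)] by metis
qed

text \<open>
  A form in the coordinates \<open>w\<close> that vanishes where \<open>w\<^sub>0 \<noteq> 0\<close> vanishes identically, since its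
  product with \<open>w\<^sub>0\<close> does.
\<close>

lemma form_eq_zero_if_affine_zero:
  fixes G :: "('n option, 'a::field_char_0) mpoly"
  assumes "G \<in> forms I k" "\<And>z. mpoly_eval G (affine_coord z) = 0"
  shows "mpoly_eval G w = 0"
proof (rule ccontr)
  assume "mpoly_eval G w \<noteq> 0"
  then obtain y where "mpoly_eval G y \<noteq> 0" "y None \<noteq> 0"
    using line_poly_common_nonzero [of "mpoly_eval G" "\<lambda>y. y None" w "\<lambda>_. 1"] by auto
  then show False
    using forms_eval_affine_coord [OF assms(1)] assms(2) by auto
qed

section \<open>Points, closures and rational maps in projective space\<close>

lemma proj_point_self [simp]: "y \<in> proj_point y"
  unfolding proj_point_def by (auto intro!: exI [of _ 1])

lemma proj_point_scale: "c \<noteq> 0 \<Longrightarrow> proj_point (\<lambda>i. c * y i) = proj_point y"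
proof -
  assume c: "c \<noteq> 0"
  have "\<exists>e. (\<lambda>i. d * y i) = (\<lambda>i. e * (c * y i)) \<and> e \<noteq> 0" if "d \<noteq> 0" for d
    using c that by (intro exI [of _ "d / c"]) (auto simp: fun_eq_iff)
  moreover have "\<exists>e. (\<lambda>i. d * (c * y i)) = (\<lambda>i. e * y i) \<and> e \<noteq> 0" if "d \<noteq> 0" for d
    using c that by (intro exI [of _ "d * c"]) (auto simp: fun_eq_iff)
  ultimately show ?thesis
    unfolding proj_point_def by blast
qed

text \<open>Nonzero vectors are proportional when all their 2 by 2 minors vanish. Equality of points
  thus becomes a family of polynomial equations, which can be checked on a dense set.\<close>

lemma proj_point_eqI:
  assumes "\<And>i. i \<notin> I \<Longrightarrow> u i = 0" "\<And>i. i \<notin> I \<Longrightarrow> y i = 0"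
    and "i \<in> I" "u i \<noteq> 0" "j \<in> I" "y j \<noteq> 0"
    and minors: "\<And>i j. i \<in> I \<Longrightarrow> j \<in> I \<Longrightarrow> u i * y j = u j * y i"
  shows "proj_point u = proj_point y"
proof -
  have "u j \<noteq> 0"
    using minors [of i j] assms(3-6) by auto
  moreover have "u = (\<lambda>i. u j / y j * y i)"
  proof
    fix l show "u l = u j / y j * y l"
      using minors [of l j] assms by (cases "l \<in> I") (auto simp: field_simps)
  qed
  ultimately show ?thesis
    using proj_point_scale [of "u j / y j" y] \<open>y j \<noteq> 0\<close> by simp
qed

lemma proj_spaceE:
  assumes "P \<in> proj_space I"
  obtains y i where "P = proj_point y" "\<And>i. i \<notin> I \<Longrightarrow> y i = 0" "i \<in> I" "y i \<noteq> 0"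
  using assms unfolding proj_space_def by auto

lemma proj_spaceI:
  "(\<And>i. i \<notin> I \<Longrightarrow> y i = 0) \<Longrightarrow> i \<in> I \<Longrightarrow> y i \<noteq> 0 \<Longrightarrow> proj_point y \<in> proj_space I"
  unfolding proj_space_def by blast

lemma forms_zero_on_proj_point_iff:
  "F \<in> forms I k \<Longrightarrow> (\<forall>u\<in>proj_point y. mpoly_eval F u = 0) \<longleftrightarrow> mpoly_eval F y = 0"
  unfolding proj_point_def
  by (auto simp: forms_eval_scale intro: exI [of _ 1])

text \<open>The common zeros of all forms vanishing on \<open>S\<close> are the smallest closed set
  containing \<open>S\<close>.\<close>

lemma zariski_closure_iff:
  assumes "S \<subseteq> proj_space I"
  shows "P \<in> zariski_closure I S \<longleftrightarrow> P \<in> proj_space I \<and>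
    (\<forall>k. \<forall>F\<in>forms I k. (\<forall>Q\<in>S. \<forall>y\<in>Q. mpoly_eval F y = 0) \<longrightarrow> (\<forall>y\<in>P. mpoly_eval F y = 0))"
    (is "_ \<longleftrightarrow> ?R")
proof
  let ?T = "{F. (\<exists>k. F \<in> forms I k) \<and> (\<forall>Q\<in>S. \<forall>y\<in>Q. mpoly_eval F y = 0)}"
  let ?Z = "{P \<in> proj_space I. \<forall>F\<in>?T. \<forall>y\<in>P. mpoly_eval F y = 0}"
  assume "P \<in> zariski_closure I S"
  moreover have "zariski_closed I ?Z"
    unfolding zariski_closed_def by (rule exI [of _ ?T]) auto
  moreover have "S \<subseteq> ?Z" using assms by auto
  ultimately have "P \<in> ?Z"
    unfolding zariski_closure_def hull_def by blast
  then show ?R by blast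
next
  assume R: ?R
  show "P \<in> zariski_closure I S"
    unfolding zariski_closure_def hull_def
  proof (intro InterI, clarify)
    fix Z assume "zariski_closed I Z" "S \<subseteq> Z"
    then obtain T where T: "T \<subseteq> (\<Union>k. forms I k)"
        "Z = {P \<in> proj_space I. \<forall>F\<in>T. \<forall>y\<in>P. mpoly_eval F y = 0}"
      unfolding zariski_closed_def by blast
    have "\<forall>y\<in>P. mpoly_eval F y = 0" if F: "F \<in> T" for F
    proof -
      obtain k where "F \<in> forms I k" using T F by blast
      moreover have "\<forall>Q\<in>S. \<forall>y\<in>Q. mpoly_eval F y = 0"
        using T \<open>S \<subseteq> Z\<close> F by blast
      ultimately show ?thesis using R by blast
    qed
    then show "P \<in> Z" using R T by blast
  qed
qed

lemma zariski_closure_subset: "S \<subseteq> zariski_closure I S"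
  by (simp add: zariski_closure_def hull_subset)

section \<open>Rational maps in terms of representatives, and density criteria\<close>

lemma proj_point_in_rat_dom_iff:
  assumes "\<And>j. j \<in> J \<Longrightarrow> F j \<in> forms I k"
  shows "proj_point y \<in> rat_dom X J F \<longleftrightarrow> proj_point y \<in> X \<and> (\<exists>j\<in>J. mpoly_eval (F j) y \<noteq> 0)"
  unfolding rat_dom_def using forms_zero_on_proj_point_iff [OF assms] by blast

text \<open>Forms of one degree scale together by \<open>c ^ k\<close>, so all representatives
  contribute the same class to the union in \<open>rat_apply\<close>.\<close>

lemma rat_apply_proj_point:
  assumes "\<And>j. j \<in> J \<Longrightarrow> F j \<in> forms I k"
  shows "rat_apply J F (proj_point y) = proj_point (\<lambda>j. if j \<in> J then mpoly_eval (F j) y else 0)"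
proof -
  have "proj_point (\<lambda>j. if j \<in> J then mpoly_eval (F j) (\<lambda>i. c * y i) else 0)
      = proj_point (\<lambda>j. if j \<in> J then mpoly_eval (F j) y else 0)" if "c \<noteq> 0" for c
  proof -
    have "(\<lambda>j. if j \<in> J then mpoly_eval (F j) (\<lambda>i. c * y i) else 0)
        = (\<lambda>j. c ^ k * (if j \<in> J then mpoly_eval (F j) y else 0))"
      by (auto simp: fun_eq_iff forms_eval_scale [OF assms])
    then show ?thesis using proj_point_scale [of "c ^ k"] that by simp
  qed
  then show ?thesis
    unfolding rat_apply_def by (auto simp: proj_point_def [of y] intro!: exI [of _ 1])
qed

text \<open>Vanishing spreads from real points to all complex affine points and then to the points
  at infinity. Identities on projective space can therefore be verified at \<open>[1, x]\<close>
  with \<open>x\<close> in the convex hull.\<close>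

lemma form_eq_zero_if_real_affine_zero:
  fixes r :: "('n::finite option, complex) mpoly" and K :: "(real ^ 'n) set"
  assumes "r \<in> forms UNIV k" "interior K \<noteq> {}"
    and "\<And>x. x \<in> K \<Longrightarrow> mpoly_eval r (affine_coord (\<lambda>i. complex_of_real (x $ i))) = 0"
  shows "mpoly_eval r w = 0"
proof (rule form_eq_zero_if_affine_zero [OF assms(1)])
  have "line_poly (\<lambda>z :: 'n \<Rightarrow> complex. affine_coord z j)" for j
    by (cases j) auto
  then have "line_poly (\<lambda>z. mpoly_eval r (affine_coord z))"
    by (rule line_poly_mpoly_eval)
  then show "mpoly_eval r (affine_coord z) = 0" for z
    using assms(2,3) by (rule line_poly_eq_zero)
qed

lemma zariski_closure_subset_closureI:
  assumes "S \<subseteq> proj_space I" "D \<subseteq> proj_space I"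
    and "\<And>k F. F \<in> forms I k \<Longrightarrow> (\<And>y. proj_point y \<in> D \<Longrightarrow> mpoly_eval F y = 0) \<Longrightarrow>
      (\<And>y. proj_point y \<in> S \<Longrightarrow> mpoly_eval F y = 0)"
  shows "zariski_closure I S \<subseteq> zariski_closure I D"
proof
  fix P assume P: "P \<in> zariski_closure I S"
  have "\<forall>Q\<in>S. \<forall>y\<in>Q. mpoly_eval F y = 0"
    if F: "F \<in> forms I k" "\<forall>Q\<in>D. \<forall>y\<in>Q. mpoly_eval F y = 0" for F k
  proof
    fix Q assume "Q \<in> S"
    then obtain y where "Q = proj_point y" using assms(1) by (auto elim: proj_spaceE)
    then show "\<forall>y\<in>Q. mpoly_eval F y = 0"
      using \<open>Q \<in> S\<close> assms(3) [OF F(1)] F forms_zero_on_proj_point_iff [OF F(1)] by auto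
  qed
  then show "P \<in> zariski_closure I D"
    using P assms(1,2) unfolding zariski_closure_iff [OF assms(1)] zariski_closure_iff [OF assms(2)]
    by blast
qed

text \<open>A form vanishing on \<open>D\<close> but not identically would be nonzero at some point
  together with \<open>q\<close> and the coordinate \<open>j\<close>, and that point lies in
  \<open>D\<close>.\<close>

lemma proj_space_subset_zariski_closure:
  assumes D: "D \<subseteq> proj_space UNIV"
    and q: "line_poly q" "q w0 \<noteq> 0"
    and mem: "\<And>w. q w \<noteq> 0 \<Longrightarrow> w j \<noteq> 0 \<Longrightarrow> proj_point w \<in> D"
  shows "proj_space UNIV \<subseteq> zariski_closure UNIV D"
proof
  fix P :: "('a \<Rightarrow> complex) set" assume P: "P \<in> proj_space UNIV"
  have "mpoly_eval F y = 0"
    if F: "F \<in> forms UNIV k" and "\<forall>Q\<in>D. \<forall>y\<in>Q. mpoly_eval F y = 0" for F k y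
  proof (rule ccontr)
    assume Fy: "mpoly_eval F y \<noteq> 0"
    have "\<exists>w. q w \<noteq> 0 \<and> w j \<noteq> 0"
      using line_poly_common_nonzero [of q "\<lambda>w. w j" w0 "\<lambda>_. 1"] q by simp
    then obtain w1 where "q w1 * w1 j \<noteq> 0" by auto
    then obtain w where "q w * w j \<noteq> 0" "mpoly_eval F w \<noteq> 0"
      using line_poly_common_nonzero [of "\<lambda>w. q w * w j" "mpoly_eval F" w1 y] q Fy
      by auto
    then show False using mem [of w] that by (auto dest: bspec)
  qed
  then show "P \<in> zariski_closure UNIV D"
    unfolding zariski_closure_iff [OF D] using P by blast
qed

lemma rat_apply_in_proj_space:
  assumes "\<And>j. j \<in> J \<Longrightarrow> F j \<in> forms I k" "X \<subseteq> proj_space I" "P \<in> rat_dom X J F"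
  shows "rat_apply J F P \<in> proj_space J"
proof -
  have "P \<in> proj_space I" using assms by (auto simp: rat_dom_def)
  then obtain y where y: "P = proj_point y" by (auto elim: proj_spaceE)
  then obtain j where "j \<in> J" "mpoly_eval (F j) y \<noteq> 0"
    using assms proj_point_in_rat_dom_iff [of J F I k] by blast
  moreover have "rat_apply J F P = proj_point (\<lambda>j. if j \<in> J then mpoly_eval (F j) y else 0)"
    unfolding y by (rule rat_apply_proj_point [OF assms(1)])
  ultimately show ?thesis
    by (auto intro!: proj_spaceI [of _ _ j])
qed

lemma zariski_closure_subset_proj_space:
  "S \<subseteq> proj_space I \<Longrightarrow> zariski_closure I S \<subseteq> proj_space I"
  by (auto simp: zariski_closure_iff)

lemma tautological_projection_forms: "tautological_projection A j \<in> forms A 1"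
  unfolding tautological_projection_def by (intro forms_sum forms_var)

section \<open>Patches with linear precision\<close>

text \<open>The functions \<open>C a\<close> stand for the normalized blending functions after
  reparametrization. Linear precision is split into its instances for the constant function
  (\<open>sum_C\<close>) and the coordinate functions (\<open>precise\<close>).\<close>

locale precise_blending =
  fixes A :: "(real ^ 'n) set" and C :: "real ^ 'n \<Rightarrow> real ^ 'n \<Rightarrow> real"
  assumes finite_A: "finite A"
    and interior_hull: "interior (convex hull A) \<noteq> {}"
    and continuous_C: "\<And>a. a \<in> A \<Longrightarrow> continuous_on (convex hull A) (C a)"
    and sum_C: "\<And>x. x \<in> convex hull A \<Longrightarrow> (\<Sum>a\<in>A. C a x) = 1"
    and precise: "\<And>x. x \<in> convex hull A \<Longrightarrow> (\<Sum>a\<in>A. C a x *\<^sub>R a) = x"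
begin

text \<open>Extension by zero off \<open>A\<close> is what homogeneous coordinates in
  \<open>proj_space A\<close> require.\<close>

definition Cv :: "real ^ 'n \<Rightarrow> real ^ 'n \<Rightarrow> complex" where
  "Cv x a = (if a \<in> A then complex_of_real (C a x) else 0)"

definition blending_points :: "(real ^ 'n \<Rightarrow> complex) set set" where
  "blending_points = (\<lambda>x. proj_point (Cv x)) ` (convex hull A)"

definition Y :: "(real ^ 'n \<Rightarrow> complex) set set" where
  "Y = zariski_closure A blending_points"

abbreviation T :: "'n option \<Rightarrow> (real ^ 'n, complex) mpoly" where
  "T \<equiv> tautological_projection A"

abbreviation real_point :: "real ^ 'n \<Rightarrow> 'n option \<Rightarrow> complex" where
  "real_point x \<equiv> affine_coord (\<lambda>i. complex_of_real (x $ i))"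

lemma eval_T: "mpoly_eval (T j) y = (\<Sum>a\<in>A. y a * complex_of_real (lift_coord a j))"
  by (rule mpoly_eval_tautological_projection [OF finite_A])

text \<open>Linear precision in projective terms: the coordinate \<open>None\<close> records that
  the \<open>C a\<close> sum to 1, the coordinate \<open>Some i\<close> that they reproduce
  \<open>x $ i\<close>.\<close>

lemma eval_T_Cv:
  assumes x: "x \<in> convex hull A"
  shows "mpoly_eval (T j) (Cv x) = real_point x j"
proof -
  have "mpoly_eval (T j) (Cv x) = complex_of_real (\<Sum>a\<in>A. C a x * lift_coord a j)"
    by (simp add: eval_T Cv_def)
  also have "(\<Sum>a\<in>A. C a x * lift_coord a j) = (case j of None \<Rightarrow> 1 | Some i \<Rightarrow> x $ i)"
  proof (cases j)
    case None
    then show ?thesis by (simp add: lift_coord_def sum_C x)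
  next
    case (Some i)
    have "(\<Sum>a\<in>A. C a x *\<^sub>R a) $ i = x $ i" using precise [OF x] by simp
    then show ?thesis using Some by (simp add: lift_coord_def sum_component)
  qed
  finally show ?thesis by (simp split: option.splits)
qed

lemma Cv_nonzero:
  assumes "x \<in> convex hull A"
  obtains a where "a \<in> A" "Cv x a \<noteq> 0"
proof -
  have "(\<Sum>a\<in>A. C a x) \<noteq> 0" using sum_C [OF assms] by simp
  then show ?thesis
    using that by (force simp: Cv_def elim: sum.not_neutral_contains_not_neutral)
qed

lemma blending_points_subset: "blending_points \<subseteq> proj_space A"
  unfolding blending_points_def
  by (auto simp: Cv_def elim!: Cv_nonzero intro!: proj_spaceI)

lemma Y_subset: "Y \<subseteq> proj_space A"
  unfolding Y_def by (rule zariski_closure_subset_proj_space [OF blending_points_subset])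

lemma Cv_in_Y: "x \<in> convex hull A \<Longrightarrow> proj_point (Cv x) \<in> Y"
  using zariski_closure_subset [of blending_points A] unfolding Y_def blending_points_def by blast

lemma form_zero_on_Y:
  assumes F: "F \<in> forms A k" and "\<And>x. x \<in> convex hull A \<Longrightarrow> mpoly_eval F (Cv x) = 0"
    and "proj_point y \<in> Y"
  shows "mpoly_eval F y = 0"
proof -
  have "\<forall>Q\<in>blending_points. \<forall>y\<in>Q. mpoly_eval F y = 0"
    unfolding blending_points_def using assms(2) forms_zero_on_proj_point_iff [OF F] by blast
  then show ?thesis
    using assms zariski_closure_iff [OF blending_points_subset] proj_point_self
    unfolding Y_def by blast
qed

lemma continuous_eval_Cv: "continuous_on (convex hull A) (\<lambda>x. mpoly_eval F (Cv x))"
proof (rule continuous_on_mpoly_eval)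
  fix a show "continuous_on (convex hull A) (\<lambda>x. Cv x a)"
    by (cases "a \<in> A") (auto simp: Cv_def intro!: continuous_intros continuous_C)
qed

text \<open>Along the blending points a form is a continuous function of \<open>x\<close>, so
  vanishing off the zeros of \<open>q\<close> forces it to vanish on the whole convex hull.\<close>

lemma Y_subset_closure:
  assumes q: "q \<noteq> 0" and D: "D \<subseteq> Y"
    and mem: "\<And>x. x \<in> convex hull A \<Longrightarrow> mpoly_eval q (($) x) \<noteq> 0 \<Longrightarrow> proj_point (Cv x) \<in> D"
  shows "Y \<subseteq> zariski_closure A D"
proof -
  have D': "D \<subseteq> proj_space A" using D Y_subset by blast
  show ?thesis
    unfolding Y_def
  proof (rule zariski_closure_subset_closureI [OF blending_points_subset D'])
    fix k F y
    assume F: "F \<in> forms A k" and zero: "\<And>y. proj_point y \<in> D \<Longrightarrow> mpoly_eval F y = 0"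
      and y: "proj_point y \<in> blending_points"
    have "mpoly_eval F (Cv x) = 0" if "x \<in> convex hull A" for x
      by (rule eq_on_if_eq_where_mpoly_nonzero [OF q convex_convex_hull _ interior_hull])
        (use that zero mem continuous_eval_Cv finite_A in
          \<open>auto intro!: compact_imp_closed finite_imp_compact_convex_hull\<close>)
    then show "mpoly_eval F y = 0"
      using form_zero_on_Y [OF F] y zariski_closure_subset [of blending_points A]
      unfolding Y_def by blast
  qed
qed

text \<open>These minors of \<open>G (T y)\<close> and \<open>y\<close> express the equality of the
  two points by forms in \<open>y\<close>, that is, by a closed condition.\<close>

lemma ex_minor_form:
  assumes "\<And>a. a \<in> A \<Longrightarrow> G a \<in> forms UNIV k" "a \<in> A" "c \<in> A"
  shows "\<exists>r\<in>forms A (k + 1). \<forall>y. mpoly_eval r y =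
    mpoly_eval (G a) (\<lambda>j. mpoly_eval (T j) y) * y c - mpoly_eval (G c) (\<lambda>j. mpoly_eval (T j) y) * y a"
proof -
  have "\<exists>r\<in>forms A (k * 1). \<forall>y. mpoly_eval r y = mpoly_eval (G a) (\<lambda>j. mpoly_eval (T j) y)"
    if "a \<in> A" for a
    by (rule ex_form_subst [OF assms(1) [OF that]]) (rule tautological_projection_forms)
  then obtain r where r: "\<And>a. a \<in> A \<Longrightarrow> r a \<in> forms A k"
    "\<And>a y. a \<in> A \<Longrightarrow> mpoly_eval (r a) y = mpoly_eval (G a) (\<lambda>j. mpoly_eval (T j) y)"
    by (metis mult.right_neutral)
  let ?X = "\<lambda>a. Poly_Mapping.single (Poly_Mapping.single a 1) 1"
  have "r a * ?X c - r c * ?X a \<in> forms A (k + 1)"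
    using assms r by (intro forms_diff forms_mult forms_var) auto
  then show ?thesis
    by (rule bexI [rotated]) (use assms r in \<open>simp add: mpoly_eval_diff mpoly_eval_mult\<close>)
qed

section \<open>From rational blending functions to an inverse rational map\<close>

lemma birational_if_rational:
  assumes q: "q \<noteq> 0"
    and g: "\<And>a x. a \<in> A \<Longrightarrow> x \<in> convex hull A \<Longrightarrow>
      mpoly_eval (g a) (($) x) = mpoly_eval q (($) x) * C a x"
  shows "birational_isomorphism A Y UNIV (proj_space UNIV) T"
proof -
  obtain N G where NG: "\<forall>a\<in>A. G a \<in> forms UNIV N \<and>
      (\<forall>z. mpoly_eval (G a) (affine_coord z) = mpoly_eval (complexify (g a)) z)"
    using ex_common_homogenization [OF finite_A, of "\<lambda>a. complexify (g a)"] by (elim exE)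
  then have G: "\<And>a. a \<in> A \<Longrightarrow> G a \<in> forms UNIV N"
    and hom: "\<And>a z. a \<in> A \<Longrightarrow> mpoly_eval (G a) (affine_coord z) = mpoly_eval (complexify (g a)) z"
    by blast+
  define Gv where "Gv w a = (if a \<in> A then mpoly_eval (G a) w else 0)" for w a
  \<comment> \<open>At real points the candidate inverse returns \<open>[C x]\<close> wherever
    \<open>q\<close> is nonzero.\<close>
  have Gv_real: "Gv (real_point x) = (\<lambda>a. complex_of_real (mpoly_eval q (($) x)) * Cv x a)"
    if "x \<in> convex hull A" for x
    using that by (simp add: fun_eq_iff Gv_def Cv_def hom mpoly_eval_complexify g)
  have T_forms: "T j \<in> forms A 1" for j by (rule tautological_projection_forms)
  have T_apply: "rat_apply UNIV T (proj_point y) = proj_point (\<lambda>j. mpoly_eval (T j) y)" for y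
    using rat_apply_proj_point [of UNIV T A 1 y] T_forms by simp
  have T_dom: "proj_point y \<in> rat_dom Y UNIV T \<longleftrightarrow>
      proj_point y \<in> Y \<and> (\<exists>j. mpoly_eval (T j) y \<noteq> 0)" for y
    using proj_point_in_rat_dom_iff [of UNIV T A 1] T_forms by simp
  have G_apply: "rat_apply A G (proj_point w) = proj_point (Gv w)" for w
    using rat_apply_proj_point [of A G UNIV N w] G unfolding Gv_def by simp
  have G_dom: "proj_point w \<in> rat_dom (proj_space UNIV) A G \<longleftrightarrow>
      proj_point w \<in> proj_space UNIV \<and> (\<exists>a\<in>A. Gv w a \<noteq> 0)" for w
    using proj_point_in_rat_dom_iff [of A G UNIV N] G by (auto simp: Gv_def)
  have real_point: "proj_point (real_point x) \<in> proj_space UNIV" for x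
    by (rule proj_spaceI [of _ _ None]) auto
  have Cv_dom: "proj_point (Cv x) \<in> rat_dom Y UNIV T" if "x \<in> convex hull A" for x
  proof -
    have "mpoly_eval (T None) (Cv x) \<noteq> 0" using eval_T_Cv [OF that, of None] by simp
    then show ?thesis unfolding T_dom using Cv_in_Y [OF that] by blast
  qed
  have T_Cv: "rat_apply UNIV T (proj_point (Cv x)) = proj_point (real_point x)"
    if "x \<in> convex hull A" for x
    using that by (simp add: T_apply eval_T_Cv)
  \<comment> \<open>The sum of the components of \<open>Gv\<close> secures density in projective
    space: it equals \<open>q\<close> at real points, and where it is nonzero \<open>G\<close> is
    defined and its value can be projected.\<close>
  have sum_Gv: "line_poly (\<lambda>w. \<Sum>a\<in>A. Gv w a)"
    by (simp add: Gv_def)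
  have sum_Gv_real: "(\<Sum>a\<in>A. Gv (real_point x) a) = complex_of_real (mpoly_eval q (($) x))"
    if "x \<in> convex hull A" for x
  proof -
    have "(\<Sum>a\<in>A. Cv x a) = complex_of_real (\<Sum>a\<in>A. C a x)" by (simp add: Cv_def)
    then show ?thesis
      using that by (simp add: Gv_real sum_C flip: sum_distrib_left)
  qed
  obtain x0 where x0: "x0 \<in> convex hull A" "mpoly_eval q (($) x0) \<noteq> 0"
    using ex_mpoly_eval_nonzero [OF q interior_hull] by blast
  then have Gv_x0: "(\<Sum>a\<in>A. Gv (real_point x0) a) \<noteq> 0"
    by (simp add: sum_Gv_real)

  have T_map: "rational_map A Y UNIV (proj_space UNIV) T"
    unfolding rational_map_def
  proof (intro conjI exI [of _ 1])
    show "Y \<subseteq> zariski_closure A (rat_dom Y UNIV T)"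
      by (rule Y_subset_closure [OF q]) (auto simp: Cv_dom, simp add: rat_dom_def)
    show "rat_apply UNIV T ` rat_dom Y UNIV T \<subseteq> proj_space UNIV"
      using rat_apply_in_proj_space [of UNIV T A 1 Y] T_forms Y_subset by blast
  qed (blast intro: T_forms)

  \<comment> \<open>A form \<open>F\<close> vanishing on the blending points pulls back along
    \<open>G\<close> to a form that vanishes at the real points, where \<open>Gv\<close> is a
    multiple of \<open>Cv x\<close>; so the pullback vanishes identically.\<close>
  have Gv_in_Y: "proj_point (Gv w) \<in> Y" if w: "a \<in> A" "Gv w a \<noteq> 0" for w a
  proof -
    have "mpoly_eval F (Gv w) = 0"
      if F: "F \<in> forms A k" and zero: "\<forall>Q\<in>blending_points. \<forall>y\<in>Q. mpoly_eval F y = 0" for F k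
    proof -
      obtain r where r: "r \<in> forms UNIV (k * N)"
        "\<And>w. mpoly_eval r w = mpoly_eval F (\<lambda>a. mpoly_eval (if a \<in> A then G a else 0) w)"
        using ex_form_subst [OF F, of "\<lambda>a. if a \<in> A then G a else 0" UNIV N] G by auto
      have eval_r: "mpoly_eval r w = mpoly_eval F (Gv w)" for w
        unfolding r Gv_def by (rule arg_cong [of _ _ "mpoly_eval F"]) auto
      have "mpoly_eval r w = 0"
      proof (rule form_eq_zero_if_real_affine_zero [OF r(1) interior_hull])
        fix x assume x: "x \<in> convex hull A"
        have "mpoly_eval F (Cv x) = 0"
          using zero x proj_point_self unfolding blending_points_def by blast
        then show "mpoly_eval r (real_point x) = 0"
          by (simp add: eval_r Gv_real [OF x] forms_eval_scale [OF F])
      qed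
      then show ?thesis by (simp add: eval_r)
    qed
    moreover have "proj_point (Gv w) \<in> proj_space A"
      by (rule proj_spaceI [of _ _ a]) (use w in \<open>auto simp: Gv_def\<close>)
    ultimately show ?thesis
      unfolding Y_def zariski_closure_iff [OF blending_points_subset]
      using forms_zero_on_proj_point_iff by blast
  qed
  have G_map: "rational_map UNIV (proj_space UNIV) A Y G"
    unfolding rational_map_def
  proof (intro conjI exI [of _ N])
    show "proj_space UNIV \<subseteq> zariski_closure UNIV (rat_dom (proj_space UNIV) A G)"
    proof (rule proj_space_subset_zariski_closure
        [where q = "\<lambda>w. \<Sum>a\<in>A. Gv w a" and j = None, OF _ sum_Gv Gv_x0])
      fix w :: "'n option \<Rightarrow> complex"
      assume "(\<Sum>a\<in>A. Gv w a) \<noteq> 0" "w None \<noteq> 0"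
      then show "proj_point w \<in> rat_dom (proj_space UNIV) A G"
        unfolding G_dom by (auto intro: proj_spaceI elim: sum.not_neutral_contains_not_neutral)
    qed (auto simp: rat_dom_def)
    show "rat_apply A G ` rat_dom (proj_space UNIV) A G \<subseteq> Y"
    proof clarify
      fix P assume P: "P \<in> rat_dom (proj_space UNIV) A G"
      then obtain w where "P = proj_point w" by (auto simp: rat_dom_def elim: proj_spaceE)
      then show "rat_apply A G P \<in> Y"
        using P Gv_in_Y by (auto simp: G_dom G_apply)
    qed
  qed (simp add: G)

  have GT: "rat_left_inverse A Y UNIV (proj_space UNIV) T G"
    unfolding rat_left_inverse_def Let_def
  proof (intro conjI ballI)
    let ?D = "{P \<in> rat_dom Y UNIV T. rat_apply UNIV T P \<in> rat_dom (proj_space UNIV) A G}"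
    show "Y \<subseteq> zariski_closure A ?D"
    proof (rule Y_subset_closure [OF q])
      fix x assume x: "x \<in> convex hull A" "mpoly_eval q (($) x) \<noteq> 0"
      then obtain a where "a \<in> A" "Cv x a \<noteq> 0" by (auto elim: Cv_nonzero)
      then have "\<exists>a\<in>A. Gv (real_point x) a \<noteq> 0" using x by (auto simp: Gv_real)
      then show "proj_point (Cv x) \<in> ?D"
        using x by (simp add: Cv_dom T_Cv G_dom real_point)
    qed (auto simp: rat_dom_def)
    fix P assume P: "P \<in> ?D"
    then have "P \<in> Y" by (auto simp: rat_dom_def)
    then obtain y i where y: "P = proj_point y" "\<And>i. i \<notin> A \<Longrightarrow> y i = 0" "i \<in> A" "y i \<noteq> 0"
      using Y_subset by (blast elim: proj_spaceE)
    let ?w = "\<lambda>j. mpoly_eval (T j) y"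
    obtain a where a: "a \<in> A" "Gv ?w a \<noteq> 0"
      using P y by (auto simp: T_apply G_dom)
    \<comment> \<open>The minors of \<open>Gv ?w\<close> and \<open>y\<close> are forms in
      \<open>y\<close> that vanish at every \<open>Cv x\<close>, hence on all of
      \<open>Y\<close>.\<close>
    have "proj_point (Gv ?w) = proj_point y"
    proof (rule proj_point_eqI [of A "Gv ?w" y a i])
      fix a c assume "a \<in> A" "c \<in> A"
      then obtain r where r: "r \<in> forms A (N + 1)" "\<And>y. mpoly_eval r y =
          mpoly_eval (G a) (\<lambda>j. mpoly_eval (T j) y) * y c - mpoly_eval (G c) (\<lambda>j. mpoly_eval (T j) y) * y a"
        using ex_minor_form [of G N a c] G by blast
      have eval_r: "mpoly_eval r y =
          Gv (\<lambda>j. mpoly_eval (T j) y) a * y c - Gv (\<lambda>j. mpoly_eval (T j) y) c * y a" for y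
        using r \<open>a \<in> A\<close> \<open>c \<in> A\<close> by (simp add: Gv_def)
      have "mpoly_eval r y = 0"
      proof (rule form_zero_on_Y [OF r(1)])
        fix x assume x: "x \<in> convex hull A"
        have "(\<lambda>j. mpoly_eval (T j) (Cv x)) = real_point x"
          using x by (simp add: fun_eq_iff eval_T_Cv)
        then show "mpoly_eval r (Cv x) = 0"
          using x by (simp add: eval_r Gv_real)
      qed (use \<open>P \<in> Y\<close> y in simp)
      then show "Gv ?w a * y c = Gv ?w c * y a" by (simp add: eval_r)
    qed (use y a in \<open>auto simp: Gv_def\<close>)
    then show "rat_apply A G (rat_apply UNIV T P) = P"
      using y by (simp add: T_apply G_apply)
  qed

  have TG: "rat_left_inverse UNIV (proj_space UNIV) A Y G T"
    unfolding rat_left_inverse_def Let_def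
  proof (intro conjI ballI)
    let ?D = "{P \<in> rat_dom (proj_space UNIV) A G. rat_apply A G P \<in> rat_dom Y UNIV T}"
    show "proj_space UNIV \<subseteq> zariski_closure UNIV ?D"
    proof (rule proj_space_subset_zariski_closure
        [where q = "\<lambda>w. \<Sum>a\<in>A. Gv w a" and j = None, OF _ sum_Gv Gv_x0])
      fix w :: "'n option \<Rightarrow> complex"
      assume w: "(\<Sum>a\<in>A. Gv w a) \<noteq> 0" "w None \<noteq> 0"
      then obtain a where a: "a \<in> A" "Gv w a \<noteq> 0"
        by (auto elim: sum.not_neutral_contains_not_neutral)
      then have "proj_point w \<in> rat_dom (proj_space UNIV) A G"
        unfolding G_dom using w by (auto intro: proj_spaceI)
      \<comment> \<open>The first component of \<open>(1, a)\<close> is 1, so this value is the sum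
        of the components of \<open>Gv w\<close>.\<close>
      moreover have "mpoly_eval (T None) (Gv w) \<noteq> 0"
        using w by (simp add: eval_T lift_coord_def)
      ultimately show "proj_point w \<in> ?D"
        using Gv_in_Y [OF a] by (auto simp: G_apply T_dom)
    qed (auto simp: rat_dom_def)
    fix P assume P: "P \<in> ?D"
    then obtain w i where w: "P = proj_point w" "w i \<noteq> 0"
      by (auto simp: rat_dom_def elim: proj_spaceE)
    let ?u = "\<lambda>w j. mpoly_eval (T j) (Gv w)"
    obtain j where j: "?u w j \<noteq> 0"
      using P w by (auto simp: G_apply T_dom)
    \<comment> \<open>Now the minors are forms on projective space. At a real point
      \<open>?u\<close> is a multiple of \<open>real_point x\<close>, so they vanish there and hence
      everywhere.\<close>
    have "proj_point (?u w) = proj_point w"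
    proof (rule proj_point_eqI [of UNIV "?u w" w j i])
      fix i j
      have "\<exists>r\<in>forms UNIV N. \<forall>w. mpoly_eval r w = ?u w j" for j
        using ex_form_subst [OF T_forms, of G UNIV N j] G by (simp add: eval_T Gv_def)
      then obtain r where r: "\<And>j. r j \<in> forms UNIV N" "\<And>j w. mpoly_eval (r j) w = ?u w j"
        by metis
      let ?X = "\<lambda>j. Poly_Mapping.single (Poly_Mapping.single j 1) 1"
      have "r i * ?X j - r j * ?X i \<in> forms UNIV (N + 1)"
        using r by (intro forms_diff forms_mult forms_var) auto
      then have "mpoly_eval (r i * ?X j - r j * ?X i) w = 0"
      proof (rule form_eq_zero_if_real_affine_zero [OF _ interior_hull])
        fix x assume x: "x \<in> convex hull A"
        then show "mpoly_eval (r i * ?X j - r j * ?X i) (real_point x) = 0"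
          by (simp add: mpoly_eval_diff mpoly_eval_mult r Gv_real forms_eval_scale [OF T_forms] eval_T_Cv)
      qed
      then show "?u w i * w j = ?u w j * w i"
        by (simp add: mpoly_eval_diff mpoly_eval_mult r)
    qed (use w j in auto)
    then show "rat_apply UNIV T (rat_apply A G P) = P"
      using w by (simp add: T_apply G_apply)
  qed

  show ?thesis
    unfolding birational_isomorphism_def using T_map G_map GT TG by blast
qed

section \<open>From a birational projection to rational blending functions\<close>

lemma rational_if_birational:
  assumes "birational_isomorphism A Y UNIV (proj_space UNIV) T"
  shows "\<exists>g q. q \<noteq> 0 \<and> (\<forall>a\<in>A. \<forall>x\<in>convex hull A.
    mpoly_eval (g a) (($) x) = mpoly_eval q (($) x) * C a x)"
proof -
  obtain G where G_map: "rational_map UNIV (proj_space UNIV) A Y G"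
    and GT: "rat_left_inverse A Y UNIV (proj_space UNIV) T G"
    using assms unfolding birational_isomorphism_def by blast
  obtain N where G: "\<And>a. a \<in> A \<Longrightarrow> G a \<in> forms UNIV N"
    and dense: "proj_space UNIV \<subseteq> zariski_closure UNIV (rat_dom (proj_space UNIV) A G)"
    using G_map unfolding rational_map_def by blast
  define Gv where "Gv w a = (if a \<in> A then mpoly_eval (G a) w else 0)" for w a
  have T_forms: "T j \<in> forms A 1" for j by (rule tautological_projection_forms)
  have T_apply: "rat_apply UNIV T (proj_point y) = proj_point (\<lambda>j. mpoly_eval (T j) y)" for y
    using rat_apply_proj_point [of UNIV T A 1 y] T_forms by simp
  have G_apply: "rat_apply A G (proj_point w) = proj_point (Gv w)" for w
    using rat_apply_proj_point [of A G UNIV N w] G unfolding Gv_def by simp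
  let ?D = "{P \<in> rat_dom Y UNIV T. rat_apply UNIV T P \<in> rat_dom (proj_space UNIV) A G}"
  have D: "?D \<subseteq> proj_space A" "Y \<subseteq> zariski_closure A ?D"
    and inverse: "\<And>P. P \<in> ?D \<Longrightarrow> rat_apply A G (rat_apply UNIV T P) = P"
    using GT Y_subset unfolding rat_left_inverse_def Let_def by (auto simp: rat_dom_def)
  \<comment> \<open>This holds even where the composite is undefined at \<open>Cv x\<close>: the
    minors vanish on the dense set \<open>?D\<close>, hence on all of \<open>Y\<close>.\<close>
  have minors: "mpoly_eval (G a) (real_point x) * Cv x c = mpoly_eval (G c) (real_point x) * Cv x a"
    if x: "x \<in> convex hull A" and ac: "a \<in> A" "c \<in> A" for x a c
  proof -
    obtain r where r: "r \<in> forms A (N + 1)" "\<And>y. mpoly_eval r y =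
        mpoly_eval (G a) (\<lambda>j. mpoly_eval (T j) y) * y c - mpoly_eval (G c) (\<lambda>j. mpoly_eval (T j) y) * y a"
      using ex_minor_form [of G N a c] G ac by blast
    have "\<forall>y\<in>P. mpoly_eval r y = 0" if P: "P \<in> ?D" for P
    proof
      fix y assume y: "y \<in> P"
      obtain y' where "P = proj_point y'" using P D(1) by (blast elim: proj_spaceE)
      then have yP: "P = proj_point y"
        using y by (auto simp: proj_point_def [of y'] proj_point_scale)
      have "proj_point (Gv (\<lambda>j. mpoly_eval (T j) y)) = proj_point y"
        using inverse [OF P] by (simp add: yP T_apply G_apply)
      then obtain e where "Gv (\<lambda>j. mpoly_eval (T j) y) = (\<lambda>a. e * y a)"
        using proj_point_self [of "Gv (\<lambda>j. mpoly_eval (T j) y)"] by (auto simp: proj_point_def)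
      then have "Gv (\<lambda>j. mpoly_eval (T j) y) a = e * y a" "Gv (\<lambda>j. mpoly_eval (T j) y) c = e * y c"
        by simp_all
      then show "mpoly_eval r y = 0"
        using ac by (simp add: r Gv_def)
    qed
    then have "\<forall>y\<in>proj_point (Cv x). mpoly_eval r y = 0"
      using D Cv_in_Y [OF x] zariski_closure_iff [OF D(1)] r(1) by blast
    then have "mpoly_eval r (Cv x) = 0" by simp
    moreover have "(\<lambda>j. mpoly_eval (T j) (Cv x)) = real_point x"
      using x by (simp add: fun_eq_iff eval_T_Cv)
    ultimately show ?thesis by (simp add: r)
  qed
  \<comment> \<open>Summing the minor identities over \<open>c\<close> replaces the sum of the
    \<open>C c\<close> by 1 and leaves \<open>s\<close> as a common denominator.\<close>
  define s where "s x = (\<Sum>c\<in>A. mpoly_eval (G c) (real_point x))" for x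
  have Gs: "mpoly_eval (G a) (real_point x) = s x * complex_of_real (C a x)"
    if x: "x \<in> convex hull A" and a: "a \<in> A" for x a
  proof -
    have "mpoly_eval (G a) (real_point x) * complex_of_real (\<Sum>c\<in>A. C c x)
        = (\<Sum>c\<in>A. mpoly_eval (G a) (real_point x) * Cv x c)"
      by (simp add: Cv_def sum_distrib_left)
    also have "\<dots> = s x * Cv x a"
      using minors [OF x a] by (simp add: s_def sum_distrib_right)
    finally show ?thesis using sum_C [OF x] a by (simp add: Cv_def)
  qed
  \<comment> \<open>Otherwise all \<open>G a\<close> vanish identically and \<open>G\<close> is
    defined nowhere. This contradicts density, since the constant form 1 of degree 0 shows that the
    empty set is closed.\<close>
  have "\<exists>x\<in>convex hull A. s x \<noteq> 0"
  proof (rule ccontr)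
    assume "\<not> ?thesis"
    then have "mpoly_eval (G a) (real_point x) = 0" if "x \<in> convex hull A" "a \<in> A" for x a
      using Gs that by simp
    then have "mpoly_eval (G a) w = 0" if "a \<in> A" for a w
      using form_eq_zero_if_real_affine_zero [OF G [OF that] interior_hull] that by blast
    then have "rat_dom (proj_space UNIV) A G = {}" by (auto simp: rat_dom_def)
    moreover have "proj_point (\<lambda>_. 1) \<in> proj_space (UNIV :: 'n option set)"
      by (rule proj_spaceI [of _ _ None]) auto
    ultimately have "proj_point (\<lambda>_. 1) \<in> zariski_closure (UNIV :: 'n option set) {}"
      using dense by auto
    then have "\<forall>F\<in>forms UNIV 0. \<forall>y\<in>proj_point (\<lambda>_ :: 'n option. 1 :: complex). mpoly_eval F y = 0"
      by (simp add: zariski_closure_iff)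
    then have "mpoly_eval 1 (\<lambda>_ :: 'n option. 1 :: complex) = 0"
      using forms_one proj_point_self by blast
    then show False by simp
  qed
  then obtain x0 where x0: "x0 \<in> convex hull A" "s x0 \<noteq> 0" by blast
  \<comment> \<open>Multiplication by the conjugate turns the value at \<open>x0\<close> into a
    positive real, so that taking real parts leaves a nonzero denominator.\<close>
  define c where "c = cnj (s x0)"
  have c: "Re (c * s x0) \<noteq> 0"
    using x0 by (simp add: c_def complex_eq_iff sum_squares_eq_zero_iff)
  have "\<exists>p :: ('n, real) mpoly. \<forall>x. mpoly_eval p x =
      Re (mpoly_eval (Poly_Mapping.single 0 c * G a) (affine_coord (\<lambda>i. complex_of_real (x i))))" for a
  proof (rule ex_mpoly_Re_eval)
    fix j :: "'n option"
    show "\<exists>r :: ('n, real) mpoly. \<forall>x. affine_coord (\<lambda>i. complex_of_real (x i)) j = complex_of_real (mpoly_eval r x)"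
    proof (cases j)
      case None
      then show ?thesis by (intro exI [of _ 1]) simp
    next
      case (Some i)
      then show ?thesis
        by (intro exI [of _ "Poly_Mapping.single (Poly_Mapping.single i 1) 1"]) simp
    qed
  qed
  then obtain g :: "real ^ 'n \<Rightarrow> ('n, real) mpoly"
    where g: "\<And>a x. mpoly_eval (g a) x =
      Re (mpoly_eval (Poly_Mapping.single 0 c * G a) (affine_coord (\<lambda>i. complex_of_real (x i))))"
    by metis
  define q where "q = (\<Sum>a\<in>A. g a)"
  have g: "mpoly_eval (g a) (($) x) = Re (c * mpoly_eval (G a) (real_point x))" for a x
    unfolding g by (simp only: mpoly_eval_mult mpoly_eval_single monom_eval_zero mult_1_right)
  have "Re (c * s x) = (\<Sum>a\<in>A. Re (c * mpoly_eval (G a) (real_point x)))" for x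
    unfolding s_def sum_distrib_left by (rule Re_sum)
  then have q: "mpoly_eval q (($) x) = Re (c * s x)" for x
    by (simp only: q_def mpoly_eval_sum g)
  have "q \<noteq> 0" using q [of x0] c by auto
  \<comment> \<open>As \<open>C a x\<close> is real, taking real parts commutes with multiplication
    by it.\<close>
  moreover have "mpoly_eval (g a) (($) x) = mpoly_eval q (($) x) * C a x"
    if "a \<in> A" "x \<in> convex hull A" for a x
    unfolding g q Gs [OF that(2,1)] by (simp add: algebra_simps)
  ultimately show ?thesis by blast
qed

end

section \<open>Normalization and reparametrization of patches\<close>

lemma sum_blending_pos:
  assumes "finite A" "patch A \<beta>" "x \<in> convex hull A"
  shows "0 < (\<Sum>a\<in>A. \<beta> a x)"
proof -
  obtain a where "a \<in> A" "\<beta> a x \<noteq> 0" using assms by (auto simp: patch_def)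
  moreover have "0 \<le> \<beta> a x" if "a \<in> A" for a using assms that by (simp add: patch_def)
  ultimately show ?thesis
    using assms(1) by (intro sum_pos2 [of _ a]) (auto simp: less_le)
qed

lemma sum_normalized:
  assumes "finite A" "patch A \<beta>" "x \<in> convex hull A"
  shows "(\<Sum>a\<in>A. normalized A \<beta> a x) = 1"
  using sum_blending_pos [OF assms] by (simp add: normalized_def flip: sum_divide_distrib)

lemma continuous_on_normalized:
  assumes "finite A" "patch A \<beta>" "a \<in> A"
  shows "continuous_on (convex hull A) (normalized A \<beta> a)"
  unfolding normalized_def
proof (intro continuous_intros ballI)
  fix x assume "x \<in> convex hull A"
  then show "(\<Sum>b\<in>A. \<beta> b x) \<noteq> 0"
    using sum_blending_pos [OF assms(1,2)] by force
qed (use assms in \<open>auto simp: patch_def\<close>)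

lemma normalized_reparam: "normalized A (reparam \<beta> \<psi>) a x = normalized A \<beta> a (\<psi> x)"
  by (simp add: normalized_def reparam_def)

text \<open>Linear precision is applied to the coordinate functions. For a proper patch this makes
  the reparametrization with linear precision unique.\<close>

lemma tautological_map_of_linear_precision:
  assumes "linear_precision A (reparam \<beta> \<psi>)" "x \<in> convex hull A"
  shows "tautological_map A \<beta> (\<psi> x) = x"
proof -
  have "tautological_map A \<beta> (\<psi> x) $ i = x $ i" for i
  proof -
    have "linear (\<lambda>x :: real ^ 'a. x $ i)" by (simp add: linear_iff)
    then have "x $ i + 0 = (\<Sum>a\<in>A. normalized A (reparam \<beta> \<psi>) a x * (a $ i + 0))"
      using assms unfolding linear_precision_def by blast
    then show ?thesis
      by (simp add: tautological_map_def normalized_reparam sum_component)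
  qed
  then show ?thesis by (simp add: vec_eq_iff)
qed

section \<open>The variety of a patch and common denominators\<close>

context precise_blending
begin

text \<open>
  The polynomials \<open>b a\<close> parametrize the variety over all of complex space, the functions \<open>C a\<close> only
  over a piece of real space; the two images have the same Zariski closure.
\<close>

lemma patch_variety_eq_Y:
  assumes h: "h \<noteq> 0"
    and \<sigma>: "continuous_on (convex hull A) \<sigma>" "\<sigma> ` (convex hull A) = convex hull A"
    and b: "\<And>a y. a \<in> A \<Longrightarrow> y \<in> convex hull A \<Longrightarrow>
      mpoly_eval (b a) (($) y) = mpoly_eval h (($) y) * C a (\<sigma> y)"
  shows "patch_variety A b = Y"
proof -
  define B where "B z a = (if a \<in> A then mpoly_eval (complexify (b a)) z else 0)" for z a
  let ?S = "{proj_point (B (($) z)) |z :: complex ^ 'n. \<exists>a\<in>A. B (($) z) a \<noteq> 0}"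
  have variety: "patch_variety A b = zariski_closure A ?S"
    unfolding patch_variety_def B_def
    by (rule arg_cong [of _ _ "zariski_closure A"]) (intro Collect_cong ex_cong conj_cong bex_cong; simp)
  have S: "?S \<subseteq> proj_space A"
    by (auto simp: B_def intro: proj_spaceI)
  have B_real: "B (\<lambda>i. complex_of_real (y $ i))
      = (\<lambda>a. complex_of_real (mpoly_eval h (($) y)) * Cv (\<sigma> y) a)" if "y \<in> convex hull A" for y
    using that by (simp add: fun_eq_iff B_def Cv_def mpoly_eval_complexify b)
  have B_line: "line_poly (\<lambda>z. B z a)" for a
    by (cases "a \<in> A") (simp_all add: B_def)
  show ?thesis
    unfolding variety Y_def
  proof (rule equalityI)
    show "zariski_closure A ?S \<subseteq> zariski_closure A blending_points"
    proof (rule zariski_closure_subset_closureI [OF S blending_points_subset])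
      fix k F y
      assume F: "F \<in> forms A k" and zero: "\<And>y. proj_point y \<in> blending_points \<Longrightarrow> mpoly_eval F y = 0"
        and y: "proj_point y \<in> ?S"
      \<comment> \<open>Over the convex hull \<open>B\<close> is a multiple of a blending vector, so
        \<open>F\<close> vanishes there; being polynomial along lines, the composite vanishes at
        every complex \<open>z\<close>.\<close>
      have B0: "mpoly_eval F (B z) = 0" for z
      proof (rule line_poly_eq_zero [of "\<lambda>z. mpoly_eval F (B z)", OF _ interior_hull])
        fix x assume x: "x \<in> convex hull A"
        then have "proj_point (Cv (\<sigma> x)) \<in> blending_points"
          unfolding blending_points_def using \<sigma> by blast
        then show "mpoly_eval F (B (\<lambda>i. complex_of_real (x $ i))) = 0"
          using zero by (simp add: B_real [OF x] forms_eval_scale [OF F])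
      qed (simp add: B_line)
      obtain z :: "complex ^ 'n" where "proj_point y = proj_point (B (($) z))" using y by blast
      then show "mpoly_eval F y = 0"
        using B0 forms_zero_on_proj_point_iff [OF F] by metis
    qed
    show "zariski_closure A blending_points \<subseteq> zariski_closure A ?S"
    proof (rule zariski_closure_subset_closureI [OF blending_points_subset S])
      fix k F y
      assume F: "F \<in> forms A k" and zero: "\<And>y. proj_point y \<in> ?S \<Longrightarrow> mpoly_eval F y = 0"
        and y: "proj_point y \<in> blending_points"
      \<comment> \<open>Where \<open>h\<close> is nonzero, \<open>Cv (\<sigma> x)\<close> is a
        rescaled value of \<open>B\<close>; continuity covers the zeros of \<open>h\<close>.
        Surjectivity of \<open>\<sigma>\<close> then reaches every blending point.\<close>
      have "mpoly_eval F (Cv (\<sigma> x)) = 0" if x: "x \<in> convex hull A" for x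
      proof (rule eq_on_if_eq_where_mpoly_nonzero [OF h convex_convex_hull _ interior_hull _ _ _ x])
        show "closed (convex hull A)"
          using finite_A by (intro compact_imp_closed finite_imp_compact_convex_hull)
        show "continuous_on (convex hull A) (\<lambda>x. mpoly_eval F (Cv (\<sigma> x)))"
          using continuous_on_compose2 [OF continuous_eval_Cv \<sigma>(1)] \<sigma>(2) by auto
        fix x assume x: "x \<in> convex hull A" "mpoly_eval h (($) x) \<noteq> 0"
        let ?z = "(\<chi> i. complex_of_real (x $ i)) :: complex ^ 'n"
        have z: "($) ?z = (\<lambda>i. complex_of_real (x $ i))" by (simp add: fun_eq_iff)
        obtain a where "a \<in> A" "Cv (\<sigma> x) a \<noteq> 0"
          using Cv_nonzero [of "\<sigma> x"] x \<sigma>(2) by blast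
        then have "\<exists>a\<in>A. B (($) ?z) a \<noteq> 0"
          unfolding z using x by (auto simp: B_real)
        then have "mpoly_eval F (B (($) ?z)) = 0"
          by (intro zero) blast
        then show "mpoly_eval F (Cv (\<sigma> x)) = 0"
          unfolding z using x by (simp add: B_real forms_eval_scale [OF F])
      qed auto
      then have "mpoly_eval F (Cv x) = 0" if "x \<in> convex hull A" for x
        using that \<sigma>(2) by (metis imageE)
      then show "mpoly_eval F y = 0"
        using form_zero_on_Y [OF F] y zariski_closure_subset [of blending_points A]
        unfolding Y_def by blast
    qed
  qed
qed

text \<open>Multiplying by the product of the denominators gives the identity where that product is
  nonzero; continuity of the \<open>C a\<close> extends it to the whole convex hull.\<close>

lemma ex_common_denominator:
  assumes "\<And>a. a \<in> A \<Longrightarrow> rational_on (convex hull A) (C a)"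
  shows "\<exists>g q. q \<noteq> 0 \<and> (\<forall>a\<in>A. \<forall>x\<in>convex hull A.
    mpoly_eval (g a) (($) x) = mpoly_eval q (($) x) * C a x)"
proof -
  obtain p r :: "real ^ 'n \<Rightarrow> ('n, real) mpoly" where r: "\<And>a. a \<in> A \<Longrightarrow> r a \<noteq> 0"
    and pr: "\<And>a x. a \<in> A \<Longrightarrow> x \<in> convex hull A \<Longrightarrow> mpoly_eval (r a) (($) x) \<noteq> 0 \<Longrightarrow>
      C a x = mpoly_eval (p a) (($) x) / mpoly_eval (r a) (($) x)"
    using assms unfolding rational_on_def by metis
  define q where "q = (\<Prod>a\<in>A. r a)"
  define g where "g a = p a * (\<Prod>c\<in>A - {a}. r c)" for a
  \<comment> \<open>The product is nonzero because, by induction, some point avoids the zeros of all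
    its factors.\<close>
  have "\<exists>x. mpoly_eval (\<Prod>a\<in>S. r a) x \<noteq> 0" if "finite S" "S \<subseteq> A" for S
    using that
  proof (induction S)
    case (insert a S)
    then obtain x y where "mpoly_eval (r a) x \<noteq> 0" "mpoly_eval (\<Prod>a\<in>S. r a) y \<noteq> 0"
      using mpoly_nonzero_eval [OF r] by blast
    then show ?case
      using insert line_poly_common_nonzero [of "mpoly_eval (r a)" "mpoly_eval (\<Prod>a\<in>S. r a)" x y]
      by (auto simp: mpoly_eval_mult)
  qed simp
  then have q: "q \<noteq> 0" using finite_A unfolding q_def by (metis mpoly_eval_zero subset_refl)
  have "mpoly_eval (g a) (($) x) = mpoly_eval q (($) x) * C a x"
    if a: "a \<in> A" and x: "x \<in> convex hull A" for a x
  proof (rule eq_on_if_eq_where_mpoly_nonzero [OF q convex_convex_hull _ interior_hull _ _ _ x])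
    show "closed (convex hull A)"
      using finite_A by (intro compact_imp_closed finite_imp_compact_convex_hull)
    show "continuous_on (convex hull A) (\<lambda>x. mpoly_eval (g a) (($) x))"
      "continuous_on (convex hull A) (\<lambda>x. mpoly_eval q (($) x) * C a x)"
      using a by (auto intro!: continuous_intros continuous_C)
    fix x assume x: "x \<in> convex hull A" "mpoly_eval q (($) x) \<noteq> 0"
    have qx: "mpoly_eval q (($) x) = mpoly_eval (r a) (($) x) * mpoly_eval (\<Prod>c\<in>A - {a}. r c) (($) x)"
      using finite_A a by (simp add: q_def mpoly_eval_prod mpoly_eval_mult prod.remove)
    then show "mpoly_eval (g a) (($) x) = mpoly_eval q (($) x) * C a x"
      using x a by (simp add: g_def mpoly_eval_mult pr)
  qed
  then show ?thesis using q by blast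
qed

lemma rational_on_if_common_denominator:
  assumes "q \<noteq> 0" "\<And>x. x \<in> convex hull A \<Longrightarrow> mpoly_eval p (($) x) = mpoly_eval q (($) x) * C a x"
  shows "rational_on (convex hull A) (C a)"
  unfolding rational_on_def using assms by (intro exI [of _ p] exI [of _ q]) auto

lemma birational_iff_rational:
  "birational_isomorphism A Y UNIV (proj_space UNIV) T \<longleftrightarrow>
    (\<forall>a\<in>A. rational_on (convex hull A) (C a))"
  using birational_if_rational rational_if_birational ex_common_denominator
    rational_on_if_common_denominator by metis

end

theorem theorem2p9:
  fixes A :: "(real ^ 'n) set"
    and \<beta> :: "real ^ 'n \<Rightarrow> real ^ 'n \<Rightarrow> real"
    and b :: "real ^ 'n \<Rightarrow> ('n, real) mpoly"
  assumes "finite A"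
    and "aff_dim (convex hull A) = int CARD('n)"
    and "patch A \<beta>"
    and "proper_patch A \<beta>"
    and "rational_patch A \<beta>"
    and "cleared_patch A \<beta> b"
  shows "rational_linear_precision A \<beta> \<longleftrightarrow>
    birational_isomorphism A (patch_variety A b)
      (UNIV :: 'n option set) (proj_space (UNIV :: 'n option set)) (tautological_projection A)"
proof -
  let ?K = "convex hull A"
  let ?\<tau> = "tautological_map A \<beta>"
  obtain \<phi> where \<phi>: "homeomorphism ?K ?K ?\<tau> \<phi>"
    using assms(4) unfolding proper_patch_def by blast
  obtain \<psi> \<phi>' h where \<psi>: "homeomorphism ?K ?K \<psi> \<phi>'" and h: "h \<noteq> 0"
    and b: "\<And>a x. a \<in> A \<Longrightarrow> x \<in> ?K \<Longrightarrow>
      mpoly_eval (b a) (($) x) = mpoly_eval h (($) x) * normalized A \<beta> a (\<psi> x)"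
    using assms(6) unfolding cleared_patch_def normalized_reparam by blast
  define C where "C a x = normalized A \<beta> a (\<phi> x)" for a x
  note \<phi>_simps = homeomorphism_apply1 [OF \<phi>] homeomorphism_apply2 [OF \<phi>]
    homeomorphism_image1 [OF \<phi>] homeomorphism_image2 [OF \<phi>]
  have \<phi>_in: "\<phi> x \<in> ?K" if "x \<in> ?K" for x using \<phi>_simps that by blast
  have \<psi>_in: "\<psi> x \<in> ?K" if "x \<in> ?K" for x using homeomorphism_image1 [OF \<psi>] that by blast
  interpret precise_blending A C
  proof
    \<comment> \<open>Full dimension makes the interior equal to the relative interior, which is
      nonempty for a nonempty convex set; the empty set has affine dimension -1.\<close>
    show "interior ?K \<noteq> {}"
      using assms(2) interior_rel_interior_gen [of ?K] rel_interior_eq_empty [of ?K]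
      by (auto simp: aff_dim_empty)
    show "continuous_on ?K (C a)" if "a \<in> A" for a
      unfolding C_def using \<phi>_in
      by (intro continuous_on_compose2 [OF continuous_on_normalized [OF assms(1,3) that]
          homeomorphism_cont2 [OF \<phi>]]) auto
    show "(\<Sum>a\<in>A. C a x) = 1" if "x \<in> ?K" for x
      unfolding C_def by (rule sum_normalized) (use assms \<phi>_in that in auto)
    show "(\<Sum>a\<in>A. C a x *\<^sub>R a) = x" if "x \<in> ?K" for x
      using \<phi>_simps(2) [OF that] by (simp add: C_def tautological_map_def)
  qed (fact assms(1))
  \<comment> \<open>The polynomials \<open>b a\<close> come from an arbitrary rational
    reparametrization \<open>\<psi>\<close>; \<open>?\<tau> \<circ> \<psi>\<close> changes its
    variables to those of linear precision, since \<open>\<phi>\<close> inverts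
    \<open>?\<tau>\<close>.\<close>
  have "patch_variety A b = Y"
  proof (rule patch_variety_eq_Y [OF h, of "?\<tau> \<circ> \<psi>"])
    show "continuous_on ?K (?\<tau> \<circ> \<psi>)"
      using homeomorphism_cont1 [OF \<phi>] homeomorphism_cont1 [OF \<psi>] homeomorphism_image1 [OF \<psi>]
      by (intro continuous_on_compose) auto
    show "(?\<tau> \<circ> \<psi>) ` ?K = ?K"
      using homeomorphism_image1 [OF \<phi>] homeomorphism_image1 [OF \<psi>] by (metis image_comp)
    show "mpoly_eval (b a) (($) y) = mpoly_eval h (($) y) * C a ((?\<tau> \<circ> \<psi>) y)"
      if "a \<in> A" "y \<in> ?K" for a y
      using that b \<psi>_in \<phi>_simps(1) by (simp add: C_def)
  qed
  moreover have "rational_linear_precision A \<beta> \<longleftrightarrow> (\<forall>a\<in>A. rational_on ?K (C a))"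
  proof
    assume "rational_linear_precision A \<beta>"
    then obtain \<rho> \<rho>' where \<rho>: "homeomorphism ?K ?K \<rho> \<rho>'" "linear_precision A (reparam \<beta> \<rho>)"
        "\<And>a. a \<in> A \<Longrightarrow> rational_on ?K (normalized A (reparam \<beta> \<rho>) a)"
      unfolding rational_linear_precision_def by blast
    \<comment> \<open>Uniqueness: \<open>?\<tau>\<close> sends \<open>\<rho> x\<close> to
      \<open>x\<close>, and \<open>\<phi>\<close> inverts \<open>?\<tau>\<close>.\<close>
    have "\<rho> x = \<phi> x" if x: "x \<in> ?K" for x
    proof -
      have "\<rho> x \<in> ?K" using homeomorphism_image1 [OF \<rho>(1)] x by blast
      then show ?thesis
        using tautological_map_of_linear_precision [OF \<rho>(2) x] \<phi>_simps(1) by metis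
    qed
    then show "\<forall>a\<in>A. rational_on ?K (C a)"
      using \<rho>(3) by (simp add: rational_on_def C_def normalized_reparam)
  next
    assume "\<forall>a\<in>A. rational_on ?K (C a)"
    moreover have "linear_precision A (reparam \<beta> \<phi>)"
      unfolding linear_precision_def normalized_reparam
    proof (intro allI impI ballI)
      fix l :: "real ^ 'n \<Rightarrow> real" and c x
      assume l: "linear l" and x: "x \<in> ?K"
      have "l x = l (\<Sum>a\<in>A. C a x *\<^sub>R a)" by (simp add: precise [OF x])
      also have "\<dots> = (\<Sum>a\<in>A. C a x * l a)"
        using l by (simp add: linear_sum linear_scale)
      finally have "l x + c = (\<Sum>a\<in>A. C a x * l a) + (\<Sum>a\<in>A. C a x) * c"
        by (simp add: sum_C [OF x])
      then show "l x + c = (\<Sum>a\<in>A. normalized A \<beta> a (\<phi> x) * (l a + c))"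
        by (simp add: C_def sum_distrib_right distrib_left sum.distrib)
    qed
    ultimately show "rational_linear_precision A \<beta>"
      unfolding rational_linear_precision_def
      using assms(4) homeomorphism_symD [OF \<phi>]
      by (intro conjI exI [of _ \<phi>] exI [of _ ?\<tau>]) (simp_all add: C_def [abs_def] normalized_reparam [abs_def])
  qed
  ultimately show ?thesis by (simp add: birational_iff_rational)
qed

end
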